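(* Let $\mu\subset\lambda$ be partitions. Write $\lambda=(\alpha\,|\,\beta)$ in Frobenius notation with $\alpha=(\alpha_1,\ldots,\alpha_p)$, $\beta=(\beta_1,\ldots,\beta_p)$, and $\mu=(\gamma\,|\,\delta)$ with $\gamma=(\gamma_1,\ldots,\gamma_q)$, $\delta=(\delta_1,\ldots,\delta_q)$ (so $p\ge q$). Then \[ S^{(r)}_{\lambda/\mu}(X)=(-1)^q\det G^{(r)}_{\lambda/\mu}(X),\qquad G^{(r)}_{\lambda/\mu}(X)=\begin{bmatrix} \left[S^{(r)}_{(\alpha_i\,|\,\beta_j)}(X)\right]_{1\le i\le p,\,1\le j\le p} & \left[h^{(r+\gamma_j+1)}_{\alpha_i-\gamma_j}(X)\right]_{1\le i\le p,\,1\le j\le q}\\[4pt] \left[e^{(r-\delta_i-1)}_{\beta_j-\delta_i}(X)\right]_{1\le i\le q,\,1\le j\le p} & O_q \end{bmatrix}, \] where $O_q$ is the $q\times q$ zero matrix.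
   Context: Let $N$ be a positive integer and $X=[x_{i,j}]_{1\le i,j\le N}$ a matrix of indeterminates. Over the field $\mathbb{C}(X)$ of rational functions write the Gauss decomposition $X=X_-X_0X_+$ with $X_-$ lower unitriangular, $X_0$ diagonal, $X_+$ upper unitriangular. For an integer $0\le r\le N$ and partitions $\mu\subset\lambda$ contained in the rectangle $((N-r)^r)$, let $I=\{\mu_{r+1-a}+a:1\le a\le r\}$, $J=\{\lambda_{r+1-a}+a:1\le a\le r\}$ and define $S^{(r)}_{\lambda/\mu}(X)$ to be the minor of $X_+$ with row set $I$ and column set $J$ (indices in increasing order); $S^{(r)}_\lambda:=S^{(r)}_{\lambda/\varnothing}$. Put $h^{(r)}_d(X)=S^{(r)}_{(d)}(X)$ and $e^{(r)}_d(X)=S^{(r)}_{(1^d)}(X)$ for $d\ge0$ (these equal $1$ for $d=0$), and $h^{(r)}_d=e^{(r)}_d=0$ for $d<0$. $N$ is assumed large enough that all quantities appearing are defined. Frobenius notation: if $\lambda$ has $p$ diagonal boxes (i.e. $p=\#\{i:\lambda_i\ge i\}$), then $\lambda=(\alpha\,|\,\beta)$ with $\alpha_i=\lambda_i-i$, $\beta_i=\lambda'_i-i$ for $1\le i\le p$, where $\lambda'$ is the conjugate partition; for integers $a,b\ge0$, $(a\,|\,b)$ denotes the hook partition $(a+1,1^b)$. *)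

theory Defs
  imports
    Complex_Main
    "HOL-Library.Poly_Mapping"
    "HOL-Library.Product_Lexorder"
    "HOL-Computational_Algebra.Fraction_Field"
    "Jordan_Normal_Form.Determinant"
    "Jordan_Normal_Form.DL_Submatrix"
begin

subsection \<open>The generic matrix and its Gauss decomposition\<close>

text \<open>
  Polynomials over the complex numbers in indeterminates indexed by pairs of naturals are finitely
  supported functions from monomials (finitely supported exponent functions) to coefficients.
  The lexicographic order on pairs is only there to make this ring an instance of class \<open>idom\<close>,
  so that its field of fractions exists. One such field serves for all matrix sizes: the generic
  matrix of size \<open>N\<close> has its entries in the subfield generated by the indeterminates with
  indices in \<open>{1..N} \<times> {1..N}\<close>.
\<close>

type_synonym mpoly_C = "((nat \<times> nat) \<Rightarrow>\<^sub>0 nat) \<Rightarrow>\<^sub>0 complex"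

type_synonym ratfun_C = "mpoly_C fract"

definition indet :: "nat \<Rightarrow> nat \<Rightarrow> ratfun_C" where
  "indet i j = Fract (Poly_Mapping.single (Poly_Mapping.single (i, j) 1) 1) 1"

text \<open>Matrix entries are addressed from 0, the indeterminates and all index sets below from 1.\<close>

definition generic_mat :: "nat \<Rightarrow> ratfun_C mat" where
  "generic_mat N = mat N N (\<lambda>(i, j). indet (i + 1) (j + 1))"

definition upper_unitriangular :: "nat \<Rightarrow> 'a::field mat \<Rightarrow> bool" where
  "upper_unitriangular n U \<longleftrightarrow>
     U \<in> carrier_mat n n \<and> upper_triangular U \<and> (\<forall>i<n. U $$ (i, i) = 1)"

definition lower_unitriangular :: "nat \<Rightarrow> 'a::field mat \<Rightarrow> bool" where
  "lower_unitriangular n L \<longleftrightarrow> upper_unitriangular n (transpose_mat L)"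

definition gauss_decomposition ::
    "'a::field mat \<Rightarrow> 'a mat \<Rightarrow> 'a mat \<Rightarrow> 'a mat \<Rightarrow> bool" where
  "gauss_decomposition A L D U \<longleftrightarrow>
     lower_unitriangular (dim_row A) L \<and>
     D \<in> carrier_mat (dim_row A) (dim_row A) \<and> diagonal_mat D \<and>
     upper_unitriangular (dim_row A) U \<and>
     A = L * D * U"

text \<open>
  For a generic matrix all leading principal minors are nonzero, so that the Gauss decomposition
  exists and is unique.
\<close>

definition gauss_upper :: "'a::field mat \<Rightarrow> 'a mat" where
  "gauss_upper A = (THE U. \<exists>L D. gauss_decomposition A L D U)"


subsection \<open>Partitions\<close>

definition is_partition :: "nat list \<Rightarrow> bool" where
  "is_partition lam \<longleftrightarrow> sorted_wrt (\<ge>) lam \<and> 0 \<notin> set lam"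

text \<open>The parts are numbered from 1, and are 0 beyond the length.\<close>

definition part :: "nat list \<Rightarrow> nat \<Rightarrow> nat" where
  "part lam i = (if 1 \<le> i \<and> i \<le> length lam then lam ! (i - 1) else 0)"

definition contained :: "nat list \<Rightarrow> nat list \<Rightarrow> bool" where
  "contained mu lam \<longleftrightarrow> (\<forall>i\<ge>1. part mu i \<le> part lam i)"

definition conjugate_partition :: "nat list \<Rightarrow> nat list" where
  "conjugate_partition lam =
     map (\<lambda>j. card {i. 1 \<le> i \<and> j \<le> part lam i}) [1..<part lam 1 + 1]"

definition hook :: "nat \<Rightarrow> nat \<Rightarrow> nat list" where
  "hook a b = (a + 1) # replicate b 1"

definition row_partition :: "nat \<Rightarrow> nat list" where
  "row_partition d = (if d = 0 then [] else [d])"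

definition column_partition :: "nat \<Rightarrow> nat list" where
  "column_partition d = replicate d 1"

text \<open>
  Frobenius notation: arms and legs are numbered from 1, and are meaningful for
  indices up to \<open>frobenius_rank lam\<close>, where the subtractions below do not truncate.
\<close>

definition frobenius_rank :: "nat list \<Rightarrow> nat" where
  "frobenius_rank lam = card {i. 1 \<le> i \<and> i \<le> part lam i}"

definition arm :: "nat list \<Rightarrow> nat \<Rightarrow> nat" where
  "arm lam i = part lam i - i"

definition leg :: "nat list \<Rightarrow> nat \<Rightarrow> nat" where
  "leg lam i = part (conjugate_partition lam) i - i"


subsection \<open>The minors $S^{(r)}_{\lambda/\mu}$\<close>

text \<open>\<open>I\<close> and \<open>J\<close> are sets of 1-based indices, shifted because \<open>submatrix\<close> takes 0-based ones.\<close>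

definition minor :: "'a::field mat \<Rightarrow> nat set \<Rightarrow> nat set \<Rightarrow> 'a" where
  "minor A I J = det (submatrix A ((\<lambda>i. i - 1) ` I) ((\<lambda>j. j - 1) ` J))"

definition index_set :: "nat \<Rightarrow> nat list \<Rightarrow> nat set" where
  "index_set r lam = {part lam (r + 1 - a) + a | a. 1 \<le> a \<and> a \<le> r}"

text \<open>
  \<open>skewS r lam mu A\<close> is meaningful if \<open>A\<close> is \<open>N \<times> N\<close>, \<open>r \<le> N\<close>, \<open>mu\<close> is contained in \<open>lam\<close>,
  and \<open>lam\<close> in the rectangle with \<open>r\<close> rows of length \<open>N - r\<close>.
\<close>

definition skewS :: "nat \<Rightarrow> nat list \<Rightarrow> nat list \<Rightarrow> 'a::field mat \<Rightarrow> 'a" where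
  "skewS r lam mu A = minor (gauss_upper A) (index_set r mu) (index_set r lam)"

abbreviation straightS :: "nat \<Rightarrow> nat list \<Rightarrow> 'a::field mat \<Rightarrow> 'a" where
  "straightS r lam A \<equiv> skewS r lam [] A"

definition h_fun :: "nat \<Rightarrow> int \<Rightarrow> 'a::field mat \<Rightarrow> 'a" where
  "h_fun r d A = (if d < 0 then 0 else straightS r (row_partition (nat d)) A)"

definition e_fun :: "nat \<Rightarrow> int \<Rightarrow> 'a::field mat \<Rightarrow> 'a" where
  "e_fun r d A = (if d < 0 then 0 else straightS r (column_partition (nat d)) A)"


subsection \<open>The matrix $G^{(r)}_{\lambda/\mu}$\<close>

text \<open>
  Arms and legs get \<open>i + 1\<close> and \<open>j + 1\<close> since matrix entries are addressed from 0. If \<open>mu\<close> has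
  at most \<open>r\<close> parts then \<open>leg mu i + 1 \<le> r\<close> for all \<open>i\<close> occurring here, so the natural number
  \<open>r - leg mu i - 1\<close> is not truncated.
\<close>

definition giambelli_mat :: "nat \<Rightarrow> nat list \<Rightarrow> nat list \<Rightarrow> 'a::field mat \<Rightarrow> 'a mat" where
  "giambelli_mat r lam mu A =
    (let p = frobenius_rank lam; q = frobenius_rank mu in
     four_block_mat
       (mat p p (\<lambda>(i, j). straightS r (hook (arm lam (i + 1)) (leg lam (j + 1))) A))
       (mat p q (\<lambda>(i, j). h_fun (r + arm mu (j + 1) + 1)
                             (int (arm lam (i + 1)) - int (arm mu (j + 1))) A))
       (mat q p (\<lambda>(i, j). e_fun (r - leg mu (i + 1) - 1)
                             (int (leg lam (j + 1)) - int (leg mu (i + 1))) A))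
       (0\<^sub>m q q))"

end

theory Submission
  imports Defs
begin

text \<open>
  Let \<open>U\<close> be the upper unitriangular Gauss factor, \<open>V\<close> its inverse, \<open>V\<^sub>r\<close> the leading
  \<open>r \<times> r\<close> block of \<open>V\<close> and \<open>M\<close> the product of \<open>V\<^sub>r\<close> with the first \<open>r\<close> rows of \<open>U\<close>. With
  0-based indices the entries of the Giambelli matrix are, up to sign, single matrix entries:
  \<open>S(a|b)\<close> is \<open>M(r-1-b, r+a)\<close>, each \<open>h\<close> is an entry of \<open>U\<close> and each \<open>e\<close> an entry of \<open>V\<close>.
  The column set of \<open>lam\<close> is \<open>{0..<r}\<close> with the positions \<open>r-1-leg\<close> replaced by \<open>r+arm\<close>, and
  likewise the row set of \<open>mu\<close>. Adjoining to the skew minor the rows missing from \<open>{0..<r}\<close>,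
  together with the corresponding unit columns, and multiplying the first \<open>r\<close> rows by \<open>V\<^sub>r\<close>
  turns the retained columns of \<open>lam\<close> into unit columns as well; expanding along these leaves the
  transpose of the Giambelli matrix.
\<close>

subsection \<open>Determinants indexed by lists\<close>

text \<open>Lists rather than sets index the rows and columns, so that reorderings and their signs
  can be expressed. Column labels may have any type; below they are often the column vectors
  themselves, which \<open>K\<close> evaluates at a row index. Lists of unequal length give 0, the
  default of \<open>det\<close> on nonsquare matrices.\<close>

definition ldet :: "('a \<Rightarrow> 'b \<Rightarrow> 'c::idom) \<Rightarrow> 'a list \<Rightarrow> 'b list \<Rightarrow> 'c" where
  "ldet K rs cs = det (mat (length rs) (length cs) (\<lambda>(i, j). K (rs ! i) (cs ! j)))"

lemma ldet_transpose: "ldet K rs cs = ldet (\<lambda>c r. K r c) cs rs"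
proof (cases "length rs = length cs")
  case True
  let ?A = "mat (length rs) (length cs) (\<lambda>(i, j). K (rs ! i) (cs ! j))"
  have "det ?A = det (transpose_mat ?A)"
    using True by (subst det_transpose[of _ "length rs"]) auto
  also have "transpose_mat ?A = mat (length cs) (length rs) (\<lambda>(j, i). K (rs ! i) (cs ! j))"
    by auto
  finally show ?thesis by (simp add: ldet_def)
next
  case False
  then show ?thesis by (simp add: ldet_def det_def)
qed

lemma ldet_cong:
  assumes "\<And>r c. r \<in> set rs \<Longrightarrow> c \<in> set cs \<Longrightarrow> K r c = K' r c"
  shows "ldet K rs cs = ldet K' rs cs"
  unfolding ldet_def by (rule arg_cong[where f = det]) (auto intro!: eq_matI assms)

lemma ldet_map: "ldet K (map f rs) (map g cs) = ldet (\<lambda>r c. K (f r) (g c)) rs cs"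
  unfolding ldet_def by (rule arg_cong[where f = det]) (auto intro!: eq_matI)

lemma ldet_single [simp]: "ldet K [r] [c] = K r c"
  by (simp add: ldet_def det_single)

section \<open>Signs of row and column rearrangements\<close>

lemma ldet_swap:
  "ldet K (xs @ y # z # ys) cs = - ldet K (xs @ z # y # ys) cs"
proof (cases "length (xs @ y # z # ys) = length cs")
  case True
  define n where "n = length cs"
  define k where "k = length xs"
  let ?A = "\<lambda>rs. mat (length rs) (length cs) (\<lambda>(i, j). K (rs ! i) (cs ! j))"
  have len: "length (xs @ z # y # ys) = n" and kn: "k < n" "Suc k < n"
    using True by (auto simp: n_def k_def)
  have "?A (xs @ y # z # ys) = swaprows k (Suc k) (?A (xs @ z # y # ys))"
  proof (rule eq_matI)
    fix i j assume "i < dim_row (swaprows k (Suc k) (?A (xs @ z # y # ys)))"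
      "j < dim_col (swaprows k (Suc k) (?A (xs @ z # y # ys)))"
    then have ij: "i < n" "j < n" using len by (auto simp: n_def)
    have nth: "(xs @ y # z # ys) ! i =
      (xs @ z # y # ys) ! (if i = k then Suc k else if i = Suc k then k else i)"
      by (auto simp: nth_append nth_Cons' k_def)
    show "?A (xs @ y # z # ys) $$ (i, j) = swaprows k (Suc k) (?A (xs @ z # y # ys)) $$ (i, j)"
      using ij kn len True nth by (auto simp: n_def)
  qed auto
  moreover have "det (swaprows k (Suc k) (?A (xs @ z # y # ys))) = - det (?A (xs @ z # y # ys))"
    using kn len by (intro det_swaprows[of _ n]) (auto simp: n_def)
  ultimately show ?thesis by (simp add: ldet_def)
next
  case False
  then show ?thesis by (simp add: ldet_def det_def)
qed

lemma ldet_move: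
  "ldet K (xs @ y # ys @ zs) cs = (-1) ^ length ys * ldet K (xs @ ys @ y # zs) cs"
proof (induction ys arbitrary: xs)
  case (Cons a ys)
  have "ldet K (xs @ y # (a # ys) @ zs) cs = - ldet K ((xs @ [a]) @ y # ys @ zs) cs"
    using ldet_swap[of K xs y a "ys @ zs" cs] by simp
  also have "\<dots> = - ((-1) ^ length ys * ldet K ((xs @ [a]) @ ys @ y # zs) cs)"
    by (simp only: Cons.IH)
  finally show ?case by simp
qed simp

lemma minus_one_power_mult_self: "(-1) ^ n * ((-1) ^ n * x) = (x :: 'a::comm_ring_1)"
  by (simp flip: mult.assoc power_mult_distrib)

lemma ldet_swap_blocks:
  "ldet K (xs @ ys @ zs @ ws) cs =
     (-1) ^ (length ys * length zs) * ldet K (xs @ zs @ ys @ ws) cs"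
proof (induction ys arbitrary: xs)
  case (Cons a ys)
  have "ldet K (xs @ (a # ys) @ zs @ ws) cs = ldet K ((xs @ [a]) @ ys @ zs @ ws) cs" by simp
  also have "\<dots> = (-1) ^ (length ys * length zs) * ldet K (xs @ a # zs @ ys @ ws) cs"
    by (subst Cons.IH) simp
  also have "ldet K (xs @ a # zs @ ys @ ws) cs =
      (-1) ^ length zs * ldet K (xs @ zs @ a # ys @ ws) cs"
    by (rule ldet_move)
  finally show ?case by (simp add: power_add)
qed simp

text \<open>The head of the list passes every later entry once, so the exponent counts pairs of
  entries.\<close>

lemma ldet_rev:
  "ldet K (xs @ rev ys @ zs) cs = (-1) ^ (length ys choose 2) * ldet K (xs @ ys @ zs) cs"
proof (induction ys arbitrary: zs)
  case (Cons a ys)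
  have "ldet K (xs @ rev (a # ys) @ zs) cs = ldet K (xs @ rev ys @ (a # zs)) cs" by simp
  also have "\<dots> = (-1) ^ (length ys choose 2) * ldet K (xs @ ys @ a # zs) cs"
    by (rule Cons.IH)
  also have "ldet K (xs @ ys @ a # zs) cs = (-1) ^ length ys * ldet K (xs @ a # ys @ zs) cs"
    unfolding ldet_move[of K xs a ys zs cs] by (rule minus_one_power_mult_self[symmetric])
  finally show ?case by (simp add: power_add numeral_2_eq_2)
qed (simp add: numeral_2_eq_2)

lemma ldet_cols_swap_blocks:
  "ldet K rs (xs @ ys @ zs @ ws) =
     (-1) ^ (length ys * length zs) * ldet K rs (xs @ zs @ ys @ ws)"
  unfolding ldet_transpose[of K] by (rule ldet_swap_blocks)

lemma ldet_cols_rev: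
  "ldet K rs (xs @ rev ys @ zs) = (-1) ^ (length ys choose 2) * ldet K rs (xs @ ys @ zs)"
  unfolding ldet_transpose[of K] by (rule ldet_rev)

text \<open>Each block length occurs once among the rows and once among the columns, so every
  reversal sign appears twice and cancels.\<close>

lemma ldet_rev_rev:
  assumes "length bs = length as" and "length ds = length gs"
  shows "ldet K (rev bs @ rev gs) (rev as @ rev ds) = ldet K (bs @ gs) (as @ ds)"
proof -
  let ?p = "(-1) ^ (length as choose 2)" and ?q = "(-1) ^ (length gs choose 2)"
  have "ldet K (rev bs @ rev gs) (rev as @ rev ds) = ?p * ldet K (bs @ rev gs) (rev as @ rev ds)"
    using ldet_rev[of K "[]" bs "rev gs"] assms by simp
  also have "\<dots> = ?p * (?q * ldet K (bs @ gs) (rev as @ rev ds))"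
    using ldet_rev[of K bs gs "[]"] by simp
  also have "\<dots> = ?p * (?q * (?p * ldet K (bs @ gs) (as @ rev ds)))"
    using ldet_cols_rev[of K _ "[]" as "rev ds"] by simp
  also have "\<dots> = ?p * (?q * (?p * (?q * ldet K (bs @ gs) (as @ ds))))"
    using ldet_cols_rev[of K _ as ds "[]"] assms by simp
  finally show ?thesis
    by (simp only: mult.left_commute[of ?q ?p] minus_one_power_mult_self)
qed

section \<open>Block triangular and unitriangular determinants\<close>

lemma mat_four_block:
  "mat (length (rs1 @ rs2)) (length (cs1 @ cs2)) (\<lambda>(i, j). K ((rs1 @ rs2) ! i) ((cs1 @ cs2) ! j)) =
   four_block_mat
     (mat (length rs1) (length cs1) (\<lambda>(i, j). K (rs1 ! i) (cs1 ! j)))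
     (mat (length rs1) (length cs2) (\<lambda>(i, j). K (rs1 ! i) (cs2 ! j)))
     (mat (length rs2) (length cs1) (\<lambda>(i, j). K (rs2 ! i) (cs1 ! j)))
     (mat (length rs2) (length cs2) (\<lambda>(i, j). K (rs2 ! i) (cs2 ! j)))"
  by (rule eq_matI) (auto simp: nth_append)

lemma ldet_block_upper:
  assumes "length rs1 = length cs1"
    and "\<And>r c. r \<in> set rs2 \<Longrightarrow> c \<in> set cs1 \<Longrightarrow> K r c = 0"
  shows "ldet K (rs1 @ rs2) (cs1 @ cs2) = ldet K rs1 cs1 * ldet K rs2 cs2"
\<comment> \<open>If the second diagonal block is not square, both sides take the default value
  0.\<close>
proof (cases "length rs2 = length cs2")
  case True
  have "mat (length rs2) (length cs1) (\<lambda>(i, j). K (rs2 ! i) (cs1 ! j)) =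
      0\<^sub>m (length rs2) (length cs1)"
    by (rule eq_matI) (auto simp: assms(2))
  then show ?thesis
    unfolding ldet_def mat_four_block using True assms(1)
    by (subst det_four_block_mat_lower_left_zero[of _ "length rs1" _ "length rs2"]) auto
next
  case False
  then show ?thesis using assms(1) by (simp add: ldet_def det_def)
qed

lemma ldet_block_lower:
  assumes "length rs1 = length cs1"
    and "\<And>r c. r \<in> set rs1 \<Longrightarrow> c \<in> set cs2 \<Longrightarrow> K r c = 0"
  shows "ldet K (rs1 @ rs2) (cs1 @ cs2) = ldet K rs1 cs1 * ldet K rs2 cs2"
  unfolding ldet_transpose[of K]
  by (rule ldet_block_upper) (use assms in auto)

lemma ldet_unitriangular:
  assumes "length rs = length cs"
    and "\<And>i. i < length rs \<Longrightarrow> K (rs ! i) (cs ! i) = 1"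
    and "\<And>i j. j < i \<Longrightarrow> i < length rs \<Longrightarrow> K (rs ! i) (cs ! j) = 0"
  shows "ldet K rs cs = 1"
proof -
  let ?A = "mat (length rs) (length cs) (\<lambda>(i, j). K (rs ! i) (cs ! j))"
  have "ldet K rs cs = prod_list (diag_mat ?A)"
    unfolding ldet_def using assms by (intro det_upper_triangular[of _ "length rs"]) auto
  also have "diag_mat ?A = map (\<lambda>i. 1) [0..<length rs]"
    unfolding diag_mat_def using assms by (intro map_cong) auto
  finally show ?thesis by (simp add: map_replicate_const)
qed

text \<open>This is left multiplication by the matrix of \<open>T\<close>, which is upper
  unitriangular in the order of \<open>rs\<close> and hence has determinant 1.\<close>

lemma ldet_row_transform:
  assumes "distinct rs" and "length rs = length cs"
    and T: "\<And>i. i < length rs \<Longrightarrow> T (rs ! i) (rs ! i) = 1"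
      "\<And>i j. j < i \<Longrightarrow> i < length rs \<Longrightarrow> T (rs ! i) (rs ! j) = 0"
  shows "ldet (\<lambda>i c. \<Sum>k\<in>set rs. T i k * K k c) rs cs = ldet K rs cs"
proof -
  let ?n = "length rs"
  let ?T = "mat ?n ?n (\<lambda>(i, j). T (rs ! i) (rs ! j))"
  let ?K = "mat ?n (length cs) (\<lambda>(i, j). K (rs ! i) (cs ! j))"
  have "mat ?n (length cs) (\<lambda>(i, j). \<Sum>k\<in>set rs. T (rs ! i) k * K k (cs ! j)) = ?T * ?K"
  proof (rule eq_matI)
    fix i j assume "i < dim_row (?T * ?K)" "j < dim_col (?T * ?K)"
    then have ij: "i < ?n" "j < length cs" by auto
    \<comment> \<open>Distinctness of \<open>rs\<close> turns the sum over its elements into the sum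
      over positions that a matrix product requires.\<close>
    have bij: "bij_betw ((!) rs) {0..<?n} (set rs)"
      using assms(1) by (auto simp: bij_betw_def inj_on_nth set_conv_nth)
    have "(\<Sum>k\<in>set rs. T (rs ! i) k * K k (cs ! j)) =
        (\<Sum>k = 0..<?n. T (rs ! i) (rs ! k) * K (rs ! k) (cs ! j))"
      using sum.reindex_bij_betw[OF bij, of "\<lambda>k. T (rs ! i) k * K k (cs ! j)"] by simp
    then show "mat ?n (length cs) (\<lambda>(i, j). \<Sum>k\<in>set rs. T (rs ! i) k * K k (cs ! j)) $$ (i, j)
        = (?T * ?K) $$ (i, j)"
      using ij assms(2) by (simp add: scalar_prod_def)
  qed auto
  moreover have "det ?T = 1"
    using ldet_unitriangular[of rs rs T] T by (simp add: ldet_def)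
  ultimately show ?thesis
    using assms(2) by (simp add: ldet_def det_mult[of _ ?n])
qed

text \<open>Moved largest first to the end of \<open>[0..<r]\<close>, each \<open>b\<close> passes exactly \<open>r - 1 - b\<close> entries,
  whatever the other elements of \<open>bs\<close> are; this is why \<open>bs\<close> ends up reversed.\<close>

lemma ldet_extract:
  assumes "sorted_wrt (<) bs" and "set bs \<subseteq> {..<r}"
  shows "ldet K (map f [0..<r] @ zs) cs =
    (-1) ^ (\<Sum>b\<leftarrow>bs. r - 1 - b) *
    ldet K (map f (filter (\<lambda>x. x \<notin> set bs) [0..<r]) @ map f (rev bs) @ zs) cs"
  using assms
proof (induction bs)
  case (Cons b bs)
  let ?R = "filter (\<lambda>x. x \<notin> set bs) [Suc b..<r]"
  let ?L = "filter (\<lambda>x. x \<notin> set (b # bs)) [0..<b]"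
  have b: "b < r" "\<forall>x\<in>set bs. b < x" using Cons.prems by auto
  have "[0..<r] = [0..<b] @ [b..<r]"
    using b(1) upt_add_eq_append[of 0 b "r - b"] by simp
  then have split: "[0..<r] = [0..<b] @ b # [Suc b..<r]"
    using b(1) by (simp add: upt_conv_Cons)
  have f1: "filter (\<lambda>x. x \<notin> set bs) [0..<r] = ?L @ b # ?R"
    unfolding split using b by (auto intro!: filter_cong)
  have f2: "filter (\<lambda>x. x \<notin> set (b # bs)) [0..<r] = ?L @ ?R"
    unfolding split using b by (auto intro!: filter_cong)
  have dist: "distinct bs" using Cons.prems(1) 
    using strict_sorted_iff by auto
  have "set ?R = {Suc b..<r} - set bs" by auto
  then have "card (set ?R) = (r - Suc b) - length bs"
    using b Cons.prems(2) distinct_card[OF dist]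
    by (subst \<open>set ?R = _\<close>, subst card_Diff_subset) (auto simp: subset_iff Suc_le_eq)
  moreover have "card (set ?R) = length ?R" by (rule distinct_card) simp
  moreover have "length bs \<le> r - Suc b"
  proof -
    have "set bs \<subseteq> {Suc b..<r}" using b Cons.prems(2) by (auto simp: Suc_le_eq)
    from card_mono[OF _ this] show ?thesis using distinct_card[OF dist] by simp
  qed
  ultimately have len: "length (?R @ rev bs) = r - 1 - b" by simp
  have "ldet K (map f [0..<r] @ zs) cs = (-1) ^ (\<Sum>b\<leftarrow>bs. r - 1 - b) *
      ldet K (map f ?L @ f b # map f (?R @ rev bs) @ zs) cs"
    using Cons.IH Cons.prems unfolding f1 by simp
  also have "ldet K (map f ?L @ f b # map f (?R @ rev bs) @ zs) cs = (-1) ^ (r - 1 - b) *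
      ldet K (map f ?L @ map f (?R @ rev bs) @ f b # zs) cs"
    by (subst ldet_move) (simp only: length_map len)
  finally show ?case unfolding f2 by (simp add: power_add mult.commute mult.left_commute)
qed simp

subsection \<open>Minors of a unitriangular matrix\<close>

lemma ldet_scale_rows:
  assumes "length rs = length cs"
  shows "ldet (\<lambda>r c. x r * K r c) rs cs = (\<Prod>r\<leftarrow>rs. x r) * ldet K rs cs"
proof -
  have "(\<Prod>i = 0..<length rs. x (rs ! i)) = (\<Prod>r\<leftarrow>rs. x r)"
    by (simp add: prod.list_conv_set_nth)
  then show ?thesis
    using assms by (simp add: ldet_def det_def prod.distrib sum_distrib_left mult_ac)
qed

lemma ldet_scale:
  assumes "length rs = length cs"
  shows "ldet (\<lambda>r c. x r * K r c * y c) rs cs =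
    (\<Prod>r\<leftarrow>rs. x r) * ldet K rs cs * (\<Prod>c\<leftarrow>cs. y c)"
proof -
  have "ldet (\<lambda>r c. x r * K r c * y c) rs cs = (\<Prod>r\<leftarrow>rs. x r) * ldet (\<lambda>r c. K r c * y c) rs cs"
    using ldet_scale_rows[OF assms, of x "\<lambda>r c. K r c * y c"] by (simp add: mult.assoc)
  also have "ldet (\<lambda>r c. K r c * y c) rs cs = ldet (\<lambda>c r. y c * K r c) cs rs"
    by (subst ldet_transpose) (simp add: mult.commute)
  also have "\<dots> = (\<Prod>c\<leftarrow>cs. y c) * ldet K rs cs"
    using assms by (simp add: ldet_scale_rows ldet_transpose[of K])
  finally show ?thesis by (simp add: mult_ac)
qed

lemma length_filter_notin_upt:
  assumes "distinct xs" "set xs \<subseteq> {..<r}"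
  shows "length (filter (\<lambda>x. x \<notin> set xs) [0..<r]) + length xs = r"
proof -
  have "length (filter (\<lambda>x. x \<notin> set xs) [0..<r]) = card (set (filter (\<lambda>x. x \<notin> set xs) [0..<r]))"
    by (rule distinct_card[symmetric]) simp
  also have "set (filter (\<lambda>x. x \<notin> set xs) [0..<r]) = {..<r} - set xs" by auto
  finally show ?thesis
    using assms card_mono[OF _ assms(2)] distinct_card[OF assms(1)] by (simp add: card_Diff_subset)
qed

section \<open>Elimination with the inverse of a unitriangular matrix\<close>

locale unitriangular_inverse =
  fixes N :: nat and u v :: "nat \<Rightarrow> nat \<Rightarrow> 'a::idom"
  assumes u_diag: "i < N \<Longrightarrow> u i i = 1"
    and u_lower: "j < i \<Longrightarrow> i < N \<Longrightarrow> u i j = 0"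
    and v_diag: "i < N \<Longrightarrow> v i i = 1"
    and v_lower: "j < i \<Longrightarrow> i < N \<Longrightarrow> v i j = 0"
    and v_mult_u: "i < N \<Longrightarrow> j < N \<Longrightarrow> (\<Sum>k<N. v i k * u k j) = (if i = j then 1 else 0)"
begin

text \<open>Coordinate \<open>i\<close> of the product of a block diagonal matrix with the vector
  \<open>f\<close>; the blocks are the leading \<open>r\<close> by \<open>r\<close> block of
  \<open>v\<close> and an identity.\<close>

definition vmul :: "nat \<Rightarrow> nat \<Rightarrow> (nat \<Rightarrow> 'a) \<Rightarrow> 'a" where
  "vmul r i f = (if i < r then \<Sum>k<r. v i k * f k else f i)"

abbreviation ucol :: "nat \<Rightarrow> nat \<Rightarrow> 'a" where
  "ucol c \<equiv> \<lambda>i. u i c"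

abbreviation unit :: "nat \<Rightarrow> nat \<Rightarrow> 'a" where
  "unit d \<equiv> \<lambda>i. if i = d then 1 else 0"

text \<open>Column \<open>c\<close> of \<open>u\<close> vanishes from row \<open>r\<close> on, so
  truncating the product of \<open>v\<close> and \<open>u\<close> to the leading block loses
  nothing.\<close>

lemma vmul_ucol:
  assumes "r \<le> N" "i < r" "c < r"
  shows "vmul r i (ucol c) = (if i = c then 1 else 0)"
proof -
  have "(\<Sum>k<N. v i k * u k c) = (\<Sum>k<r. v i k * u k c)"
    using assms by (intro sum.mono_neutral_right) (auto intro!: u_lower)
  then show ?thesis using v_mult_u[of i c] assms by (simp add: vmul_def)
qed

lemma vmul_unit:
  assumes "d < r"
  shows "vmul r i (unit d) = (if i < r then v i d else 0)"
  using assms by (auto simp: vmul_def if_distrib[where f = "\<lambda>x. _ * x"] cong: if_cong)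

text \<open>Left multiplication by the block matrix behind \<open>vmul\<close> has determinant 1 and
  turns the columns \<open>c < r\<close> of \<open>u\<close> into unit columns. Once the rows
  \<open>bs\<close> are moved behind the other rows below \<open>r\<close>, the matrix is block
  upper triangular with an identity as first block, so the sign is that of the move alone. The
  columns \<open>zs\<close> are arbitrary vectors, which admits unit vectors among them.\<close>

lemma ldet_reduce:
  assumes "r \<le> N" and bs: "sorted_wrt (<) bs" "set bs \<subseteq> {..<r}"
    and ys: "distinct ys" "set ys \<subseteq> {r..<N}"
    and len: "length zs = length bs + length ys"
  shows "ldet (\<lambda>i f. f i) ([0..<r] @ ys) (map ucol (filter (\<lambda>x. x \<notin> set bs) [0..<r]) @ zs) =
    (-1) ^ (\<Sum>b\<leftarrow>bs. r - 1 - b) * ldet (vmul r) (rev bs @ ys) zs"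
proof -
  let ?C = "filter (\<lambda>x. x \<notin> set bs) [0..<r]"
  let ?rs = "[0..<r] @ ys" and ?cs = "map ucol ?C @ zs"
  \<comment> \<open>The matrix of \<open>vmul r\<close> on the row labels. Its part on
    \<open>ys\<close> is an identity, hence triangular in whatever order \<open>ys\<close> is
    listed.\<close>
  let ?T = "\<lambda>i k. if i < r then if k < r then v i k else 0 else if i = k then 1 else 0"
  have "distinct bs" using bs(1) strict_sorted_iff by auto
  then have "length ?C + length bs = r" using bs(2) by (rule length_filter_notin_upt)
  then have lens: "length ?rs = length ?cs" using len by simp
  have "ldet (\<lambda>i f. f i) ?rs ?cs = ldet (\<lambda>i f. \<Sum>k\<in>set ?rs. ?T i k * f k) ?rs ?cs"
  proof (rule ldet_row_transform[symmetric])
    show "distinct ?rs" using ys by auto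
    then have inj: "i < length ?rs \<Longrightarrow> j < length ?rs \<Longrightarrow> ?rs ! i = ?rs ! j \<longleftrightarrow> i = j" for i j
      by (simp only: nth_eq_iff_index_eq)
    have r: "?rs ! i < r \<longleftrightarrow> i < r" if "i < length ?rs" for i
      using that ys by (auto simp: nth_append subset_iff) (metis add.right_neutral
         le_add_diff_inverse less_diff_conv2 not_less nth_mem add.commute)
    have rr: "?rs ! i = i" if "i < r" for i using that by (simp add: nth_append)
    show "?T (?rs ! i) (?rs ! i) = 1" if "i < length ?rs" for i
      using r[OF that] rr assms(1) by (auto intro!: v_diag)
    show "?T (?rs ! i) (?rs ! j) = 0" if "j < i" "i < length ?rs" for i j
      using r[of i] r[of j] rr inj[of i j] that assms(1) by (auto intro!: v_lower)
  qed (use lens in simp)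
  also have "\<dots> = ldet (vmul r) ?rs ?cs"
  proof (rule ldet_cong)
    fix i and f :: "nat \<Rightarrow> 'a" assume i: "i \<in> set ?rs"
    have "set ?rs = {..<r} \<union> set ys" by auto
    then have "(\<Sum>k\<in>set ?rs. ?T i k * f k) = (\<Sum>k<r. ?T i k * f k) + (\<Sum>k\<in>set ys. ?T i k * f k)"
      using ys by (simp only:, subst sum.union_disjoint) (auto simp: subset_iff)
    also have "\<dots> = vmul r i f"
    proof (cases "i < r")
      case True
      have "(\<Sum>k\<in>set ys. ?T i k * f k) = 0" using True ys by (intro sum.neutral) (auto simp: subset_iff)
      then show ?thesis using True by (simp add: vmul_def)
    next
      case False
      then have "(\<Sum>k<r. ?T i k * f k) = 0" by (intro sum.neutral) auto
      moreover have "(\<Sum>k\<in>set ys. ?T i k * f k) = (\<Sum>k\<in>set ys. if i = k then f k else 0)"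
        using False by (intro sum.cong) auto
      ultimately show ?thesis using False i by (simp add: vmul_def)
    qed
    finally show "(\<Sum>k\<in>set ?rs. ?T i k * f k) = vmul r i f" .
  qed
  also have "\<dots> = (-1) ^ (\<Sum>b\<leftarrow>bs. r - 1 - b) * ldet (vmul r) (?C @ rev bs @ ys) ?cs"
    using ldet_extract[OF bs, of "vmul r" "\<lambda>x. x" ys ?cs] by simp
  also have "ldet (vmul r) (?C @ rev bs @ ys) ?cs =
      ldet (vmul r) ?C (map ucol ?C) * ldet (vmul r) (rev bs @ ys) zs"
  proof (rule ldet_block_upper)
    fix i f assume "i \<in> set (rev bs @ ys)" "f \<in> set (map ucol ?C)"
    then obtain c where i: "i \<in> set bs \<or> i \<in> set ys" and c: "c < r" "c \<notin> set bs" "f = ucol c" by auto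
    from i show "vmul r i f = 0"
    proof
      assume "i \<in> set bs"
      then show ?thesis using vmul_ucol[of r i c] c bs assms(1) by auto
    next
      assume "i \<in> set ys"
      then show ?thesis using ys c u_lower[of c i] by (auto simp: vmul_def subset_iff)
    qed
  qed simp
  also have "ldet (vmul r) ?C (map ucol ?C) = 1"
  proof (rule ldet_unitriangular)
    fix i j assume ij: "j < i" "i < length ?C"
    then have "?C ! i \<in> set ?C" "?C ! j \<in> set ?C" by (intro nth_mem; linarith)+
    moreover have "?C ! i \<noteq> ?C ! j" using ij nth_eq_iff_index_eq[of ?C i j] by simp
    ultimately have "vmul r (?C ! i) (ucol (?C ! j)) = 0"
      using assms(1) by (subst vmul_ucol) (simp_all del: nth_mem)
    then show "vmul r (?C ! i) (map ucol ?C ! j) = 0" using ij by simp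
  next
    fix i assume i: "i < length ?C"
    then have "?C ! i \<in> set ?C" by (intro nth_mem)
    then show "vmul r (?C ! i) (map ucol ?C ! i) = 1"
      using i assms(1) by (simp add: vmul_ucol)
  qed simp
  finally show ?thesis by simp
qed

section \<open>Hook, row, column and skew minors\<close>

lemma ldet_u: "ldet u rs cs = ldet (\<lambda>i f. f i) rs (map ucol cs)"
  using ldet_map[of "\<lambda>i f. f i" "\<lambda>x. x" rs ucol cs] by simp

text \<open>With a single missing position, elimination leaves a one by one determinant.\<close>

lemma hook_minor:
  assumes "r \<le> N" "b < r"
  shows "ldet u [0..<r] (filter (\<lambda>x. x \<noteq> b) [0..<r] @ [c]) =
    (-1) ^ (r - 1 - b) * vmul r b (ucol c)"
  using ldet_reduce[of r "[b]" "[]" "[ucol c]"] assms by (simp add: ldet_u)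

text \<open>The last row vanishes in all columns before \<open>s - 1\<close>, which splits off a
  unitriangular block.\<close>

lemma row_minor:
  assumes "0 < s" "s \<le> N"
  shows "ldet u [0..<s] ([0..<s - 1] @ [c]) = u (s - 1) c"
proof -
  have s: "[0..<s] = [0..<s - 1] @ [s - 1]" using assms(1) by (cases s) auto
  have "ldet u [0..<s] ([0..<s - 1] @ [c]) = ldet u [0..<s - 1] [0..<s - 1] * ldet u [s - 1] [c]"
    unfolding s using assms by (intro ldet_block_upper) (auto intro!: u_lower)
  moreover have "ldet u [0..<s - 1] [0..<s - 1] = 1"
    using assms by (intro ldet_unitriangular) (auto intro!: u_lower u_diag)
  ultimately show ?thesis by simp
qed

text \<open>This is the cofactor formula for the inverse: one determinant, bordered by row
  \<open>t - 1\<close> and a unit column, is evaluated in two ways.\<close>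

lemma column_minor:
  assumes "b < t" "t \<le> N"
  shows "ldet u [0..<t - 1] (filter (\<lambda>x. x \<noteq> b) [0..<t]) = (-1) ^ (t - 1 - b) * v b (t - 1)"
proof -
  let ?C = "filter (\<lambda>x. x \<noteq> b) [0..<t]"
  have t: "[0..<t] = [0..<t - 1] @ [t - 1]" using assms(1) by (cases t) auto
  have len: "length ?C = t - 1" using length_filter_notin_upt[of "[b]" t] assms(1) by simp
  \<comment> \<open>Expansion along the unit column gives the minor.\<close>
  have "ldet (\<lambda>i f. f i) ([0..<t - 1] @ [t - 1]) (map ucol ?C @ [unit (t - 1)]) =
      ldet (\<lambda>i f. f i) [0..<t - 1] (map ucol ?C) * ldet (\<lambda>i f. f i) [t - 1] [unit (t - 1)]"
    using len by (intro ldet_block_lower) auto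
  \<comment> \<open>Elimination in the same determinant gives the entry of \<open>v\<close>.\<close>
  moreover have "ldet (\<lambda>i f. f i) ([0..<t] @ []) (map ucol (filter (\<lambda>x. x \<notin> set [b]) [0..<t]) @ [unit (t - 1)]) =
     (-1) ^ (t - 1 - b) * vmul t b (unit (t - 1))"
    using ldet_reduce[of t "[b]" "[]" "[unit (t - 1)]"] assms by simp
  ultimately show ?thesis
    using assms t by (simp add: ldet_u vmul_unit)
qed

text \<open>Adjoining the unit columns at the positions \<open>ds\<close> turns the minor into one to which
  \<open>ldet_reduce\<close> applies.\<close>

lemma skew_minor:
  assumes "r \<le> N" and bs: "sorted_wrt (<) bs" "set bs \<subseteq> {..<r}"
    and ds: "sorted_wrt (<) ds" "set ds \<subseteq> {..<r}"
    and gs: "distinct gs" "set gs \<subseteq> {r..<N}"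
    and len: "length as = length bs" "length gs = length ds"
  shows "ldet u (filter (\<lambda>x. x \<notin> set ds) [0..<r] @ rev gs)
                (filter (\<lambda>x. x \<notin> set bs) [0..<r] @ rev as) =
    (-1) ^ (length ds + (\<Sum>b\<leftarrow>bs. r - 1 - b) + (\<Sum>d\<leftarrow>ds. r - 1 - d)) *
    ldet (vmul r) (bs @ gs) (map ucol as @ map unit ds)"
proof -
  let ?C = "filter (\<lambda>x. x \<notin> set bs) [0..<r]" and ?R = "filter (\<lambda>x. x \<notin> set ds) [0..<r]"
  let ?ev = "\<lambda>i (f :: nat \<Rightarrow> 'a). f i"
  let ?D = "map unit (rev ds)" and ?A = "map ucol (rev as)"
  let ?sb = "\<Sum>b\<leftarrow>bs. r - 1 - b" and ?sd = "\<Sum>d\<leftarrow>ds. r - 1 - d"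
  define p q where "p = length bs" and "q = length ds"
  have "set ds \<inter> set gs = {}" using ds(2) gs(2) by fastforce
  have "distinct bs" "distinct ds" using bs(1) ds(1) strict_sorted_iff by auto
  have C: "length ?C + p = r" and R: "length ?R + q = r"
    using bs(2) ds(2) \<open>distinct bs\<close> \<open>distinct ds\<close>
    by (simp_all add: length_filter_notin_upt p_def q_def)
  \<comment> \<open>First evaluation: the rows \<open>ds\<close> and the unit columns are moved to
    the front and split off as an identity block, which leaves the skew minor.\<close>
  have "ldet ?ev ([0..<r] @ rev gs) (map ucol ?C @ ?D @ ?A) =
      (-1) ^ ?sd * ldet ?ev (?R @ rev ds @ rev gs) (map ucol ?C @ ?D @ ?A)"
    using ldet_extract[OF ds, of ?ev "\<lambda>x. x" "rev gs"] by simp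
  also have "ldet ?ev (?R @ rev ds @ rev gs) (map ucol ?C @ ?D @ ?A) =
      (-1) ^ (length ?R * q) * ldet ?ev (rev ds @ ?R @ rev gs) (map ucol ?C @ ?D @ ?A)"
    using ldet_swap_blocks[of ?ev "[]" ?R "rev ds" "rev gs"] by (simp add: q_def)
  also have "ldet ?ev (rev ds @ ?R @ rev gs) (map ucol ?C @ ?D @ ?A) =
      (-1) ^ (length ?C * q) * ldet ?ev (rev ds @ ?R @ rev gs) (?D @ map ucol ?C @ ?A)"
    using ldet_cols_swap_blocks[of ?ev _ "[]" "map ucol ?C" ?D ?A] by (simp add: q_def)
  also have "ldet ?ev (rev ds @ ?R @ rev gs) (?D @ map ucol ?C @ ?A) =
      ldet ?ev (rev ds) ?D * ldet ?ev (?R @ rev gs) (map ucol ?C @ ?A)"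
    using \<open>set ds \<inter> set gs = {}\<close> by (intro ldet_block_upper) auto
  also have "ldet ?ev (rev ds) ?D = 1"
  proof (rule ldet_unitriangular)
    fix i j assume ij: "j < i" "i < length (rev ds)"
    then have "rev ds ! i \<noteq> rev ds ! j"
      using \<open>distinct ds\<close> nth_eq_iff_index_eq[of "rev ds" i j] by simp
    then show "(?D ! j) (rev ds ! i) = 0" using ij by simp
  qed auto
  also have "ldet ?ev (?R @ rev gs) (map ucol ?C @ ?A) = ldet u (?R @ rev gs) (?C @ rev as)"
    by (simp add: ldet_u)
  finally have 1: "ldet ?ev ([0..<r] @ rev gs) (map ucol ?C @ ?D @ ?A) =
      (-1) ^ (?sd + length ?R * q + length ?C * q) * ldet u (?R @ rev gs) (?C @ rev as)"
    by (simp add: power_add)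
  \<comment> \<open>Second evaluation of the same determinant, by elimination; the reversals among
    rows and columns then cancel.\<close>
  have "ldet ?ev ([0..<r] @ rev gs) (map ucol ?C @ ?D @ ?A) =
      (-1) ^ ?sb * ldet (vmul r) (rev bs @ rev gs) (?D @ ?A)"
    using gs len by (intro ldet_reduce[OF assms(1) bs]) auto
  also have "ldet (vmul r) (rev bs @ rev gs) (?D @ ?A) =
      (-1) ^ (q * p) * ldet (vmul r) (rev bs @ rev gs) (?A @ ?D)"
    using ldet_cols_swap_blocks[of "vmul r" _ "[]" ?D ?A "[]"] len by (simp add: q_def p_def)
  also have "ldet (vmul r) (rev bs @ rev gs) (?A @ ?D) =
      ldet (vmul r) (bs @ gs) (map ucol as @ map unit ds)"
    unfolding rev_map[symmetric] using len by (intro ldet_rev_rev) simp_all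
  finally have 2: "ldet ?ev ([0..<r] @ rev gs) (map ucol ?C @ ?D @ ?A) =
      (-1) ^ (?sb + q * p) * ldet (vmul r) (bs @ gs) (map ucol as @ map unit ds)"
    by (simp add: power_add)
  define e where "e = ?sd + length ?R * q + length ?C * q"
  have "ldet u (?R @ rev gs) (?C @ rev as) = (-1) ^ e * ((-1) ^ e * ldet u (?R @ rev gs) (?C @ rev as))"
    by (rule minus_one_power_mult_self[symmetric])
  also have "\<dots> = (-1) ^ e * ((-1) ^ (?sb + q * p) * ldet (vmul r) (bs @ gs) (map ucol as @ map unit ds))"
    unfolding e_def 1[symmetric] 2 ..
  also have "\<dots> = (-1) ^ (e + (?sb + q * p)) * ldet (vmul r) (bs @ gs) (map ucol as @ map unit ds)"
    by (simp add: power_add mult.assoc)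
  also have "(-1 :: 'a) ^ (e + (?sb + q * p)) = (-1) ^ (length ds + ?sb + ?sd)"
  proof -
    \<comment> \<open>The block moves contribute \<open>(length ?R + length ?C + p) * q\<close> to
      the exponent. Since \<open>length ?R + q\<close> and \<open>length ?C + p\<close> both equal
      \<open>r\<close>, this has the parity of \<open>q * q\<close>, hence of \<open>q\<close>. Here
      the sign \<open>(-1)^q\<close> of the theorem arises.\<close>
    have "even (length ?R + q + (length ?C + p))" using C R by simp
    then have "even (e + (?sb + q * p)) = even (length ds + ?sb + ?sd)"
      by (auto simp: e_def q_def)
    then show ?thesis by (simp add: minus_one_power_iff)
  qed
  finally show ?thesis .
qed

end

subsection \<open>The Gauss decomposition of the generic matrix\<close>

lemma det_upper_unitriangular:
  assumes "upper_unitriangular n U"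
  shows "det U = 1"
proof -
  have "det U = prod_list (diag_mat U)"
    using assms by (intro det_upper_triangular[of _ n]) (auto simp: upper_unitriangular_def)
  also have "diag_mat U = map (\<lambda>i. 1) [0..<n]"
    unfolding diag_mat_def using assms by (intro map_cong) (auto simp: upper_unitriangular_def)
  finally show ?thesis by (simp add: map_replicate_const)
qed

lemma obtain_inverse_mat:
  fixes A :: "'a::field mat"
  assumes "A \<in> carrier_mat n n" and "det A \<noteq> 0"
  obtains B where "B \<in> carrier_mat n n" "A * B = 1\<^sub>m n" "B * A = 1\<^sub>m n"
  using det_non_zero_imp_unit[OF assms, of undefined]
  by (auto simp: Units_def ring_mat_simps)

text \<open>Entry \<open>(i, j)\<close> of \<open>V * U = 1\<close> expresses
  \<open>V $$ (i, j)\<close> through entries of the same row in earlier columns, so the zeros below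
  the diagonal follow by induction on the column.\<close>

lemma upper_unitriangular_inverse:
  assumes U: "upper_unitriangular n U" and V: "V \<in> carrier_mat n n" "V * U = 1\<^sub>m n"
  shows "upper_unitriangular n V"
proof -
  have Uc: "U \<in> carrier_mat n n" and Ud: "\<And>i. i < n \<Longrightarrow> U $$ (i, i) = 1"
    and Ul: "\<And>i j. j < i \<Longrightarrow> i < n \<Longrightarrow> U $$ (i, j) = 0"
    using U by (auto simp: upper_unitriangular_def)
  have eq: "V $$ (i, j) + (\<Sum>k<j. V $$ (i, k) * U $$ (k, j)) = (if i = j then 1 else 0)"
    if "i < n" "j < n" for i j
  proof -
    have "(if i = j then 1 else 0) = (V * U) $$ (i, j)" using V that by simp
    also have "\<dots> = (\<Sum>k = 0..<n. V $$ (i, k) * U $$ (k, j))"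
      using V(1) Uc that by (simp add: scalar_prod_def)
    also have "\<dots> = (\<Sum>k \<in> insert j {..<j}. V $$ (i, k) * U $$ (k, j))"
      using that by (intro sum.mono_neutral_right) (auto intro!: Ul)
    finally show ?thesis using Ud[OF that(2)] by simp
  qed
  have low: "V $$ (i, j) = 0" if "j < i" "i < n" for i j
    using that
  proof (induction j rule: less_induct)
    case (less j)
    then have "(\<Sum>k<j. V $$ (i, k) * U $$ (k, j)) = 0" by (intro sum.neutral) auto
    then show ?case using eq[of i j] less.prems by simp
  qed
  have "V $$ (i, i) = 1" if "i < n" for i
  proof -
    have "(\<Sum>k<i. V $$ (i, k) * U $$ (k, i)) = 0" using low that by (intro sum.neutral) auto
    then show ?thesis using eq[of i i] that by simp
  qed
  then show ?thesis using V(1) low by (auto simp: upper_unitriangular_def)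
qed

lemma unitriangular_inverse_mat:
  assumes "upper_unitriangular n U" and "upper_unitriangular n V" and "V * U = 1\<^sub>m n"
  shows "unitriangular_inverse n (\<lambda>i j. U $$ (i, j)) (\<lambda>i j. V $$ (i, j))"
proof
  fix i j assume ij: "i < n" "j < n"
  have "(if i = j then 1 else 0) = (V * U) $$ (i, j)" using assms(3) ij by simp
  also have "\<dots> = (\<Sum>k = 0..<n. V $$ (i, k) * U $$ (k, j))"
    using assms(1,2) ij unfolding upper_unitriangular_def by (auto simp: scalar_prod_def)
  finally show "(\<Sum>k<n. V $$ (i, k) * U $$ (k, j)) = (if i = j then 1 else 0)"
    by (simp add: atLeast0LessThan)
qed (use assms in \<open>auto simp: upper_unitriangular_def\<close>)

lemma upper_unitriangular_mult:
  assumes "upper_unitriangular n U" and "upper_unitriangular n V"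
  shows "upper_unitriangular n (U * V)"
proof -
  have c: "U \<in> carrier_mat n n" "V \<in> carrier_mat n n"
    and d: "\<And>i. i < n \<Longrightarrow> U $$ (i, i) = 1" "\<And>i. i < n \<Longrightarrow> V $$ (i, i) = 1"
    and l: "\<And>i j. j < i \<Longrightarrow> i < n \<Longrightarrow> U $$ (i, j) = 0" "\<And>i j. j < i \<Longrightarrow> i < n \<Longrightarrow> V $$ (i, j) = 0"
    using assms by (auto simp: upper_unitriangular_def)
  have entry: "(U * V) $$ (i, j) = (\<Sum>k = 0..<n. U $$ (i, k) * V $$ (k, j))" if "i < n" "j < n" for i j
    using c that by (simp add: scalar_prod_def)
  have "(U * V) $$ (i, j) = 0" if "j < i" "i < n" for i j
  proof -
    have "U $$ (i, k) * V $$ (k, j) = 0" if "k < n" for k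
      using l(1)[of k i] l(2)[of j k] \<open>j < i\<close> \<open>i < n\<close> that by (cases "k < i") auto
    then show ?thesis using that by (subst entry) (auto intro!: sum.neutral)
  qed
  moreover have "(U * V) $$ (i, i) = 1" if "i < n" for i
  proof -
    have "(U * V) $$ (i, i) = (\<Sum>k \<in> {i}. U $$ (i, k) * V $$ (k, i))"
      unfolding entry[OF that that]
    proof (rule sum.mono_neutral_right)
      show "\<forall>k\<in>{0..<n} - {i}. U $$ (i, k) * V $$ (k, i) = 0"
      proof
        fix k assume "k \<in> {0..<n} - {i}"
        then show "U $$ (i, k) * V $$ (k, i) = 0"
          using l(1)[of k i] l(2)[of i k] that by (cases "k < i") auto
      qed
    qed (use that in auto)
    then show ?thesis using d that by simp
  qed
  ultimately show ?thesis using c by (auto simp: upper_unitriangular_def)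
qed

section \<open>Uniqueness and existence of the Gauss decomposition\<close>

lemma gauss_decomposition_carrier:
  assumes "A \<in> carrier_mat n n"
  shows "gauss_decomposition A L D U \<longleftrightarrow>
     lower_unitriangular n L \<and> D \<in> carrier_mat n n \<and> diagonal_mat D \<and>
     upper_unitriangular n U \<and> A = L * D * U"
  unfolding gauss_decomposition_def carrier_matD(1)[OF assms] ..

text \<open>With \<open>P = L * D\<close>, \<open>P' = L' * D'\<close> and \<open>Q\<close> the
  quotient of the two upper factors, \<open>P * Q = P'\<close>. Here \<open>Q\<close> is upper
  unitriangular and \<open>P\<close>, \<open>P'\<close> are lower triangular. Since
  \<open>det A\<close> is nonzero, \<open>P\<close> has a nonzero diagonal, and this forces the
  entries of \<open>Q\<close> above its diagonal to vanish.\<close>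

lemma gauss_decomposition_unique:
  assumes "A \<in> carrier_mat n n" and "det A \<noteq> 0"
    and g: "gauss_decomposition A L D U" and g': "gauss_decomposition A L' D' U'"
  shows "U = U'"
proof -
  have lower: "L * D \<in> carrier_mat n n \<and> U \<in> carrier_mat n n \<and> A = (L * D) * U \<and>
      (\<forall>i j. i < j \<longrightarrow> j < n \<longrightarrow> (L * D) $$ (i, j) = 0)"
    if "gauss_decomposition A L D U" for L D U
  proof -
    have L: "upper_unitriangular n L\<^sup>T" and U: "upper_unitriangular n U"
      and D: "D \<in> carrier_mat n n" "diagonal_mat D" and A: "A = L * D * U"
      using that unfolding gauss_decomposition_carrier[OF assms(1)] lower_unitriangular_def by blast+
    have c: "L \<in> carrier_mat n n" "D \<in> carrier_mat n n" "U \<in> carrier_mat n n"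
      using L U D by (auto simp: upper_unitriangular_def)
    have Ll: "L $$ (i, j) = 0" if "i < j" "j < n" for i j
    proof -
      have "L\<^sup>T $$ (j, i) = 0"
        using L that unfolding upper_unitriangular_def upper_triangular_def by auto
      then show ?thesis using c that by simp
    qed
    have "(L * D) $$ (i, j) = 0" if "i < j" "j < n" for i j
    proof -
      have "(L * D) $$ (i, j) = (\<Sum>k = 0..<n. L $$ (i, k) * D $$ (k, j))"
        using c that by (simp add: scalar_prod_def)
      also have "\<dots> = 0"
      proof (rule sum.neutral, rule ballI)
        fix k assume "k \<in> {0..<n}"
        then show "L $$ (i, k) * D $$ (k, j) = 0"
          using Ll[OF that] D(2) c that by (cases "k = j") (auto simp: diagonal_mat_def)
      qed
      finally show ?thesis .
    qed
    then show ?thesis using c A by auto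
  qed
  define P P' where "P = L * D" and "P' = L' * D'"
  have P: "P \<in> carrier_mat n n" "A = P * U" "\<And>i j. i < j \<Longrightarrow> j < n \<Longrightarrow> P $$ (i, j) = 0"
    using lower[OF g] unfolding P_def by blast+
  have P': "P' \<in> carrier_mat n n" "A = P' * U'" "\<And>i j. i < j \<Longrightarrow> j < n \<Longrightarrow> P' $$ (i, j) = 0"
    using lower[OF g'] unfolding P'_def by blast+
  have U: "upper_unitriangular n U" and U': "upper_unitriangular n U'"
    using g g' unfolding gauss_decomposition_carrier[OF assms(1)] by blast+
  then have Uc: "U \<in> carrier_mat n n" "U' \<in> carrier_mat n n"
    by (auto simp: upper_unitriangular_def)
  obtain V' where V': "V' \<in> carrier_mat n n" "U' * V' = 1\<^sub>m n" "V' * U' = 1\<^sub>m n"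
    using obtain_inverse_mat[OF Uc(2)] det_upper_unitriangular[OF U'] by auto
  define Q where "Q = U * V'"
  have "upper_unitriangular n Q"
    unfolding Q_def
    by (rule upper_unitriangular_mult[OF U upper_unitriangular_inverse[OF U' V'(1,3)]])
  then have Q: "Q \<in> carrier_mat n n" "\<And>i. i < n \<Longrightarrow> Q $$ (i, i) = 1"
      "\<And>i j. j < i \<Longrightarrow> i < n \<Longrightarrow> Q $$ (i, j) = 0"
    by (auto simp: upper_unitriangular_def)
  have "P * Q = A * V'" unfolding Q_def P(2) using P(1) Uc V'(1) by simp
  also have "\<dots> = P'" unfolding P'(2) using P'(1) Uc V' by simp
  finally have PQ: "P * Q = P'" .
  have "det P \<noteq> 0" using assms(2) P(1) Uc unfolding P(2) by (auto simp: det_mult)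
  then have diag: "P $$ (i, i) \<noteq> 0" if "i < n" for i
    using det_lower_triangular[of n P] P(1,3) that
    by (auto simp: prod_list_zero_iff diag_mat_def)
  \<comment> \<open>Induction on the row: in entry \<open>(i, j)\<close> of \<open>P * Q\<close>,
    terms with \<open>k > i\<close> vanish by the shape of \<open>P\<close> and terms with
    \<open>k < i\<close> by the induction hypothesis, so only
    \<open>P $$ (i, i) * Q $$ (i, j)\<close> remains.\<close>
  have Q0: "Q $$ (i, j) = 0" if "i < j" "j < n" for i j
    using that
  proof (induction i rule: less_induct)
    case (less i)
    have "0 = (P * Q) $$ (i, j)" using P'(3) PQ less.prems by simp
    also have "\<dots> = (\<Sum>k = 0..<n. P $$ (i, k) * Q $$ (k, j))"
      using P(1) Q(1) less.prems by (simp add: scalar_prod_def)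
    also have "\<dots> = (\<Sum>k \<in> {i}. P $$ (i, k) * Q $$ (k, j))"
    proof (rule sum.mono_neutral_right)
      show "\<forall>k\<in>{0..<n} - {i}. P $$ (i, k) * Q $$ (k, j) = 0"
      proof
        fix k assume "k \<in> {0..<n} - {i}"
        then show "P $$ (i, k) * Q $$ (k, j) = 0"
          using P(3)[of i k] less.IH[of k] less.prems by (cases "k < i") auto
      qed
    qed (use less.prems in auto)
    finally show ?case using diag less.prems by simp
  qed
  have "Q = 1\<^sub>m n"
  proof (rule eq_matI)
    fix i j assume "i < dim_row (1\<^sub>m n)" "j < dim_col (1\<^sub>m n)"
    then show "Q $$ (i, j) = 1\<^sub>m n $$ (i, j)"
      using Q Q0 by (cases i j rule: linorder_cases) auto
  qed (use Q in auto)
  then have "U * V' * U' = U'" using Uc by (simp add: Q_def)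
  then show ?thesis using Uc V' by simp
qed

text \<open>Induction by bordering: a decomposition of the leading block of size \<open>n\<close> is
  extended by one row and one column. The nonzero determinant of that block makes its three factors
  invertible.\<close>

lemma gauss_decomposition_exists:
  fixes A :: "'a::field mat"
  assumes "A \<in> carrier_mat n n"
    and "\<And>k. k \<le> n \<Longrightarrow> det (mat k k (\<lambda>ij. A $$ ij)) \<noteq> 0"
  shows "\<exists>L D U. gauss_decomposition A L D U"
  using assms
proof (induction n arbitrary: A)
  case 0
  then have "gauss_decomposition A (1\<^sub>m 0) (1\<^sub>m 0) (1\<^sub>m 0)"
    by (auto simp: gauss_decomposition_def lower_unitriangular_def upper_unitriangular_def
      diagonal_mat_def)
  then show ?case by blast
next
  case (Suc n)
  define A' where "A' = mat n n (\<lambda>ij. A $$ ij)"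
  define b where "b = mat n 1 (\<lambda>(i, j). A $$ (i, n))"
  define c where "c = mat 1 n (\<lambda>(i, j). A $$ (n, j))"
  define d where "d = mat 1 1 (\<lambda>_. A $$ (n, n))"
  have Ac: "A' \<in> carrier_mat n n" "b \<in> carrier_mat n 1" "c \<in> carrier_mat 1 n" "d \<in> carrier_mat 1 1"
    by (auto simp: A'_def b_def c_def d_def)
  have A: "A = four_block_mat A' b c d"
    using Suc.prems(1) by (intro eq_matI) (auto simp: A'_def b_def c_def d_def less_Suc_eq)
  have "mat k k (\<lambda>ij. A' $$ ij) = mat k k (\<lambda>ij. A $$ ij)" if "k \<le> n" for k
    using that by (auto simp: A'_def)
  then have "\<exists>L D U. gauss_decomposition A' L D U"
    using Suc.prems Ac by (intro Suc.IH) auto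
  then obtain L D U where "gauss_decomposition A' L D U" by blast
  then have L: "upper_unitriangular n L\<^sup>T" and D: "D \<in> carrier_mat n n" "diagonal_mat D"
    and U: "upper_unitriangular n U" and A': "A' = L * D * U"
    using Ac by (auto simp: gauss_decomposition_def lower_unitriangular_def)
  have Lc: "L \<in> carrier_mat n n" and Uc: "U \<in> carrier_mat n n"
    using L U by (auto simp: upper_unitriangular_def)
  have LD: "L * D \<in> carrier_mat n n" using Lc D by simp
  have "det (L * D * U) \<noteq> 0" using Suc.prems(2)[of n] A' by (simp add: A'_def)
  then have dets: "det (L * D) \<noteq> 0" "det D \<noteq> 0" "det U \<noteq> 0"
    using Lc D Uc LD by (auto simp: det_mult)
  obtain LDi where LDi: "LDi \<in> carrier_mat n n" "L * D * LDi = 1\<^sub>m n"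
    using obtain_inverse_mat[OF LD dets(1)] by blast
  obtain Di where Di: "Di \<in> carrier_mat n n" "Di * D = 1\<^sub>m n"
    using obtain_inverse_mat[OF D(1) dets(2)] by blast
  obtain Ui where Ui: "Ui \<in> carrier_mat n n" "Ui * U = 1\<^sub>m n"
    using obtain_inverse_mat[OF Uc dets(3)] by blast
  \<comment> \<open>The new blocks solve \<open>L * D * w = b\<close>, \<open>l * D * U = c\<close>
    and \<open>l * D * w + e = d\<close>; the last pivot \<open>e\<close> is the Schur
    complement.\<close>
  define w l where "w = LDi * b" and "l = c * Ui * Di"
  define e where "e = d - l * D * w"
  have car: "w \<in> carrier_mat n 1" "l \<in> carrier_mat 1 n" "e \<in> carrier_mat 1 1"
    using Ac LDi Di Ui D by (auto simp: w_def l_def e_def)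
  define LL where "LL = four_block_mat L (0\<^sub>m n 1) l (1\<^sub>m 1)"
  define DD where "DD = four_block_mat D (0\<^sub>m n 1) (0\<^sub>m 1 n) e"
  define UU where "UU = four_block_mat U w (0\<^sub>m 1 n) (1\<^sub>m 1)"
  have "LL * DD = four_block_mat (L * D) (0\<^sub>m n 1) (l * D) e"
    unfolding LL_def DD_def
    by (subst mult_four_block_mat[of _ n n _ 1 _ 1 _ _ n _ 1]) (use Lc D car in auto)
  then have "LL * DD * UU = four_block_mat (L * D * U) (L * D * w) (l * D * U) (l * D * w + e)"
    unfolding UU_def
    by (simp, subst mult_four_block_mat[of _ n n _ 1 _ 1 _ _ n _ 1]) (use Lc D Uc car in auto)
  also have "L * D * w = b"
    using LDi LD Ac by (simp add: w_def flip: assoc_mult_mat[OF LD LDi(1) Ac(2)])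
  also have "l * D * U = c"
  proof -
    have "l * D = c * Ui * (Di * D)" unfolding l_def
      by (rule assoc_mult_mat) (use Ac Ui Di D in auto)
    then have "l * D = c * Ui" using Di Ac Ui by simp
    moreover have "c * Ui * U = c * (Ui * U)" by (rule assoc_mult_mat) (use Ac Ui Uc in auto)
    ultimately show ?thesis using Ui Ac by simp
  qed
  also have "l * D * w + e = d"
    using Ac car D by (intro eq_matI) (auto simp: e_def)
  finally have prod: "A = LL * DD * UU" using A A' by simp
  have "lower_unitriangular (Suc n) LL"
    using L Lc car unfolding lower_unitriangular_def upper_unitriangular_def LL_def upper_triangular_def
    by (auto simp: less_Suc_eq)
  moreover have "upper_unitriangular (Suc n) UU"
    using U Uc car unfolding upper_unitriangular_def UU_def upper_triangular_def by (auto simp: less_Suc_eq)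
  moreover have "DD \<in> carrier_mat (Suc n) (Suc n)" "diagonal_mat DD"
    using D car unfolding DD_def diagonal_mat_def by (auto simp: less_Suc_eq)
  ultimately have "gauss_decomposition A LL DD UU"
    using prod unfolding gauss_decomposition_carrier[OF Suc.prems(1)] by blast
  then show ?case by blast
qed

section \<open>Nonzero leading principal minors of the generic matrix\<close>

lemma prod_single:
  fixes m :: "nat \<Rightarrow> 'a::comm_monoid_add"
  shows "(\<Prod>i<k. Poly_Mapping.single (m i) (1::'b::comm_semiring_1)) =
    Poly_Mapping.single (\<Sum>i<k. m i) 1"
  by (induction k) (auto simp: mult_single)

text \<open>The diagonal monomial occurs in the Leibniz expansion only for the identity permutation.\<close>

lemma det_indeterminates_nonzero:
  "det (mat k k (\<lambda>(i, j). Poly_Mapping.single (Poly_Mapping.single (i + 1, j + 1) 1) 1) :: mpoly_C mat) \<noteq> 0"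
proof -
  let ?A = "mat k k (\<lambda>(i, j). Poly_Mapping.single (Poly_Mapping.single (i + 1, j + 1) 1) 1) :: mpoly_C mat"
  define m :: "(nat \<Rightarrow> nat) \<Rightarrow> (nat \<times> nat) \<Rightarrow>\<^sub>0 nat" where
    "m p = (\<Sum>i<k. Poly_Mapping.single (i + 1, p i + 1) 1)" for p
  let ?P = "{p. p permutes {0..<k}}"
  have "det ?A = (\<Sum>p\<in>?P. signof p * (\<Prod>i = 0..<k. ?A $$ (i, p i)))"
    by (rule det_def') simp
  also have "\<dots> = (\<Sum>p\<in>?P. signof p * Poly_Mapping.single (m p) 1)"
  proof (rule sum.cong[OF refl])
    fix p assume "p \<in> ?P"
    then have "(\<Prod>i = 0..<k. ?A $$ (i, p i)) =
        (\<Prod>i = 0..<k. Poly_Mapping.single (Poly_Mapping.single (i + 1, p i + 1) 1) 1)"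
      by (intro prod.cong) (auto dest: permutes_in_image)
    then show "signof p * (\<Prod>i = 0..<k. ?A $$ (i, p i)) = signof p * Poly_Mapping.single (m p) 1"
      by (simp only: m_def prod_single atLeast0LessThan)
  qed
  finally have "Poly_Mapping.lookup (det ?A) (m id) =
      (\<Sum>p\<in>?P. Poly_Mapping.lookup (signof p * Poly_Mapping.single (m p) 1) (m id))"
    by (simp add: lookup_sum)
  also have "\<dots> = (\<Sum>p\<in>?P. if p = id then 1 else 0)"
  proof (rule sum.cong[OF refl])
    fix p assume p: "p \<in> ?P"
    show "Poly_Mapping.lookup (signof p * Poly_Mapping.single (m p) (1 :: complex)) (m id) =
        (if p = id then 1 else 0)"
    proof (cases "p = id")
      case False
      then obtain i where i: "p i \<noteq> i" by (auto simp: fun_eq_iff)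
      then have "i < k" using p by (auto simp: permutes_def)
      \<comment> \<open>The exponent of the diagonal indeterminate in row \<open>i + 1\<close>
        distinguishes the two monomials.\<close>
      have "Poly_Mapping.lookup (m p) (i + 1, i + 1) = 0"
        using i by (auto simp: m_def lookup_sum lookup_single when_def)
      moreover have "Poly_Mapping.lookup (m id) (i + 1, i + 1) = 1"
        using \<open>i < k\<close> by (simp add: m_def lookup_sum lookup_single when_def)
      ultimately have "m p \<noteq> m id" by auto
      then show ?thesis using False by (auto simp: sign_def lookup_single)
    qed (simp add: sign_id)
  qed
  also have "\<dots> = 1"
    by (simp add: permutes_id finite_permutations)
  finally show ?thesis by auto
qed

lemma det_leading_generic_mat:
  assumes "k \<le> N"
  shows "det (mat k k (\<lambda>ij. generic_mat N $$ ij)) \<noteq> 0"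
proof -
  interpret fract: comm_ring_hom "\<lambda>x :: mpoly_C. Fract x 1"
    by unfold_locales (auto simp: Zero_fract_def One_fract_def)
  let ?A = "mat k k (\<lambda>(i, j). Poly_Mapping.single (Poly_Mapping.single (i + 1, j + 1) 1) 1) :: mpoly_C mat"
  have "mat k k (\<lambda>ij. generic_mat N $$ ij) = map_mat (\<lambda>x. Fract x 1) ?A"
    using assms by (intro eq_matI) (auto simp: generic_mat_def indet_def)
  then have "det (mat k k (\<lambda>ij. generic_mat N $$ ij)) = Fract (det ?A) 1"
    by (simp only: fract.hom_det)
  also have "\<dots> \<noteq> Fract 0 1"
    using det_indeterminates_nonzero[of k] by (subst eq_fract(1)) (simp_all only: mult_1_right, simp_all)
  finally show ?thesis unfolding Zero_fract_def .
qed

lemma upper_unitriangular_gauss_upper: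
  "upper_unitriangular N (gauss_upper (generic_mat N))"
proof -
  let ?A = "generic_mat N"
  have A: "?A \<in> carrier_mat N N" by (simp add: generic_mat_def)
  obtain L D U where g: "gauss_decomposition ?A L D U"
    using gauss_decomposition_exists[OF A det_leading_generic_mat] by blast
  have "mat N N (\<lambda>ij. ?A $$ ij) = ?A" using A by auto
  then have "det ?A \<noteq> 0" using det_leading_generic_mat[of N N] by simp
  \<comment> \<open>Uniqueness resolves the description \<open>THE U\<close> in
    \<open>gauss_upper\<close>.\<close>
  then have "gauss_upper ?A = U"
    unfolding gauss_upper_def using g gauss_decomposition_unique[OF A]
    by (intro the_equality) blast+
  then show ?thesis using g A by (simp add: gauss_decomposition_def)
qed

subsection \<open>Partitions and index sets\<close>

text \<open>\<open>pick\<close> selects by rank, and exactly \<open>i\<close> elements of the set,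
  those at earlier positions, lie below \<open>xs ! i\<close>.\<close>

lemma pick_set_sorted:
  assumes "sorted_wrt (<) xs" and "i < length xs"
  shows "pick (set xs) i = xs ! i"
proof -
  have less: "xs ! k < xs ! i \<longleftrightarrow> k < i" if "k < length xs" for k
    using sorted_wrt_nth_less[OF assms(1), of k i] sorted_wrt_nth_less[OF assms(1), of i k]
      assms(2) that by (cases k i rule: linorder_cases) auto
  have "{a \<in> set xs. a < xs ! i} = (!) xs ` {..<i}"
  proof (intro equalityI subsetI)
    fix x assume "x \<in> {a \<in> set xs. a < xs ! i}"
    then obtain k where "k < length xs" "x = xs ! k" "xs ! k < xs ! i" by (auto simp: in_set_conv_nth)
    then show "x \<in> (!) xs ` {..<i}" using less[of k] by auto
  next
    fix x assume "x \<in> (!) xs ` {..<i}"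
    then obtain k where "k < i" "x = xs ! k" by auto
    then show "x \<in> {a \<in> set xs. a < xs ! i}" using less[of k] assms(2) by simp
  qed
  moreover have "inj_on ((!) xs) {..<i}"
    using assms by (auto intro!: inj_on_nth simp: strict_sorted_iff)
  ultimately have "card {a \<in> set xs. a < xs ! i} = i" by (simp add: card_image)
  then show ?thesis using pick_card_in_set[of "xs ! i" "set xs"] assms(2) by simp
qed

lemma det_submatrix_eq_ldet:
  assumes "A \<in> carrier_mat n n"
    and xs: "sorted_wrt (<) xs" "set xs \<subseteq> {..<n}" and ys: "sorted_wrt (<) ys" "set ys \<subseteq> {..<n}"
  shows "det (submatrix A (set xs) (set ys)) = ldet (\<lambda>i j. A $$ (i, j)) xs ys"
proof -
  have "{i. i < n \<and> i \<in> set zs} = set zs" "card (set zs) = length zs"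
    if "sorted_wrt (<) zs" "set zs \<subseteq> {..<n}" for zs
    using that by (auto simp: strict_sorted_iff distinct_card)
  then show ?thesis
    using assms(1) xs ys unfolding submatrix_def ldet_def
    by (intro arg_cong[where f = det] eq_matI) (auto simp: pick_set_sorted)
qed

text \<open>Substituting \<open>a = r + 1 - i\<close> and passing to 0-based indices places row
  \<open>i\<close> of the partition at \<open>part lam i + (r - i)\<close>.\<close>

lemma index_set_shift:
  "(\<lambda>i. i - 1) ` index_set r lam = (\<lambda>i. part lam i + (r - i)) ` {1..r}"
proof -
  have "index_set r lam = (\<lambda>a. part lam (r + 1 - a) + a) ` {1..r}"
    by (auto simp: index_set_def)
  also have "{1..r} = (\<lambda>i. r + 1 - i) ` {1..r}"
  proof (intro equalityI subsetI)
    fix i assume "i \<in> {1..r}"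
    then show "i \<in> (\<lambda>i. r + 1 - i) ` {1..r}" by (intro image_eqI[of _ _ "r + 1 - i"]) auto
  qed auto
  finally show ?thesis by (auto simp: image_image intro!: image_cong)
qed

lemma skewS_eq_ldet:
  assumes "gauss_upper A \<in> carrier_mat n n"
    and "sorted_wrt (<) xs" "set xs \<subseteq> {..<n}" and "sorted_wrt (<) ys" "set ys \<subseteq> {..<n}"
    and "set xs = (\<lambda>i. part mu i + (r - i)) ` {1..r}"
    and "set ys = (\<lambda>i. part lam i + (r - i)) ` {1..r}"
  shows "skewS r lam mu A = ldet (\<lambda>i j. gauss_upper A $$ (i, j)) xs ys"
  using det_submatrix_eq_ldet[OF assms(1-5)]
  unfolding skewS_def minor_def index_set_shift assms(6,7) .

section \<open>Index sets of hooks, rows and columns\<close>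

lemma part_Nil [simp]: "part [] i = 0"
  by (simp add: part_def)

lemma part_replicate: "part (replicate m k) i = (if 1 \<le> i \<and> i \<le> m then k else 0)"
  by (auto simp: part_def)

lemma part_map:
  "part (map f xs) i = (if 1 \<le> i \<and> i \<le> length xs then f (xs ! (i - 1)) else 0)"
  by (auto simp: part_def)

lemma part_hook: "part (hook a b) i = (if i = 1 then a + 1 else if 1 < i \<and> i \<le> b + 1 then 1 else 0)"
  by (auto simp: part_def hook_def nth_Cons')

lemma part_row: "part (row_partition d) i = (if i = 1 then d else 0)"
  by (auto simp: part_def row_partition_def)

lemma index_empty: "{..<r} = (\<lambda>i. part [] i + (r - i)) ` {1..r}"
proof (intro equalityI subsetI)
  fix x assume "x \<in> {..<r}"
  then show "x \<in> (\<lambda>i. part [] i + (r - i)) ` {1..r}" by (intro image_eqI[of _ _ "r - x"]) auto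
qed auto

text \<open>The first row lands on \<open>r + a\<close>; the \<open>b\<close> rows of length one
  each move up by one position and together vacate \<open>r - 1 - b\<close>.\<close>

lemma index_hook:
  assumes "b < r"
  shows "{..<r} - {r - 1 - b} \<union> {r + a} = (\<lambda>i. part (hook a b) i + (r - i)) ` {1..r}"
proof (intro equalityI subsetI)
  fix x assume "x \<in> {..<r} - {r - 1 - b} \<union> {r + a}"
  then consider "x = r + a" | "x < r - 1 - b" | "r - 1 - b < x" "x < r"
    by fastforce
  then show "x \<in> (\<lambda>i. part (hook a b) i + (r - i)) ` {1..r}"
  proof cases
    case 1
    then show ?thesis using assms by (intro image_eqI[of _ _ 1]) (auto simp: part_hook)
  next
    case 2
    then show ?thesis using assms by (intro image_eqI[of _ _ "r - x"]) (auto simp: part_hook)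
  next
    case 3
    then show ?thesis using assms by (intro image_eqI[of _ _ "r + 1 - x"]) (auto simp: part_hook)
  qed
qed (use assms in \<open>auto simp: part_hook split: if_splits\<close>)

lemma index_row:
  assumes "0 < s"
  shows "{..<s - 1} \<union> {s - 1 + d} = (\<lambda>i. part (row_partition d) i + (s - i)) ` {1..s}"
proof (intro equalityI subsetI)
  fix x assume "x \<in> {..<s - 1} \<union> {s - 1 + d}"
  then consider "x = s - 1 + d" | "x < s - 1" by fastforce
  then show "x \<in> (\<lambda>i. part (row_partition d) i + (s - i)) ` {1..s}"
  proof cases
    case 1
    then show ?thesis using assms by (intro image_eqI[of _ _ 1]) (auto simp: part_row)
  next
    case 2
    then show ?thesis using assms by (intro image_eqI[of _ _ "s - x"]) (auto simp: part_row)
  qed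
qed (use assms in \<open>auto simp: part_row split: if_splits\<close>)

lemma index_column:
  assumes "d \<le> s"
  shows "{..<s + 1} - {s - d} = (\<lambda>i. part (column_partition d) i + (s - i)) ` {1..s}"
proof (intro equalityI subsetI)
  fix x assume "x \<in> {..<s + 1} - {s - d}"
  then consider "x < s - d" | "s - d < x" "x \<le> s" by fastforce
  then show "x \<in> (\<lambda>i. part (column_partition d) i + (s - i)) ` {1..s}"
  proof cases
    case 1
    then show ?thesis using assms
      by (intro image_eqI[of _ _ "s - x"]) (auto simp: column_partition_def part_replicate)
  next
    case 2
    then show ?thesis using assms
      by (intro image_eqI[of _ _ "s + 1 - x"]) (auto simp: column_partition_def part_replicate)
  qed
qed (use assms in \<open>auto simp: column_partition_def part_replicate split: if_splits\<close>)

lemma initial_segment: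
  fixes S :: "nat set"
  assumes "S \<subseteq> {1..r}" and "\<And>i j. 1 \<le> i \<Longrightarrow> i \<le> j \<Longrightarrow> j \<in> S \<Longrightarrow> i \<in> S"
  shows "S = {1..card S}"
proof (cases "S = {}")
  case False
  have fin: "finite S" using assms(1) finite_subset by blast
  have "S = {1..Max S}"
  proof (intro equalityI subsetI)
    fix x assume "x \<in> S"
    then show "x \<in> {1..Max S}" using assms(1) Max_ge[OF fin] by auto
  next
    fix x assume "x \<in> {1..Max S}"
    then show "x \<in> S" using assms(2)[of x "Max S"] Max_in[OF fin False] by simp
  qed
  moreover have "card {1..Max S} = Max S" by simp
  ultimately show ?thesis by (metis (no_types))
qed simp

section \<open>Frobenius coordinates of a partition in the rectangle\<close>

locale partition_in_rectangle =
  fixes lam :: "nat list" and r N :: nat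
  assumes partition: "is_partition lam"
    and in_rectangle: "contained lam (replicate r (N - r))"
    and r_le_N: "r \<le> N"
begin

abbreviation rank :: nat where "rank \<equiv> frobenius_rank lam"

lemma part_antimono:
  assumes "1 \<le> i" "i \<le> j"
  shows "part lam j \<le> part lam i"
proof (cases "i < j \<and> j \<le> length lam")
  case True
  then have "lam ! (i - 1) \<ge> lam ! (j - 1)"
    using partition assms by (intro sorted_wrt_nth_less[of "(\<ge>)" lam]) (auto simp: is_partition_def)
  then show ?thesis using True assms by (simp add: part_def)
next
  case False
  then show ?thesis using assms by (cases "i = j") (auto simp: part_def)
qed

lemma part_le: "1 \<le> i \<Longrightarrow> part lam i \<le> (if i \<le> r then N - r else 0)"
  using in_rectangle by (simp add: contained_def part_replicate)

text \<open>Common source for the diagonal length and the column heights: a condition inherited by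
  earlier rows holds on an initial segment of rows, and positivity of the parts bounds that segment
  by \<open>r\<close>.\<close>

lemma initial_segment_part:
  assumes "\<And>i. P i \<Longrightarrow> 0 < part lam i"
    and "\<And>i j. 1 \<le> i \<Longrightarrow> i \<le> j \<Longrightarrow> part lam j \<le> part lam i \<Longrightarrow> P j \<Longrightarrow> P i"
  shows "{i. 1 \<le> i \<and> P i} = {1..card {i. 1 \<le> i \<and> P i}}"
proof (rule initial_segment)
  show "{i. 1 \<le> i \<and> P i} \<subseteq> {1..r}"
  proof
    fix i assume "i \<in> {i. 1 \<le> i \<and> P i}"
    then show "i \<in> {1..r}" using assms(1)[of i] part_le[of i] by (simp split: if_splits)
  qed
next
  fix i j :: nat assume "1 \<le> i" "i \<le> j" "j \<in> {i. 1 \<le> i \<and> P i}"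
  then show "i \<in> {i. 1 \<le> i \<and> P i}" using assms(2)[of i j] part_antimono[of i j] by blast
qed

lemma le_rank_iff:
  assumes "1 \<le> i"
  shows "i \<le> rank \<longleftrightarrow> i \<le> part lam i"
proof -
  \<comment> \<open>The conjunct \<open>0 < part lam i\<close> excludes \<open>i = 0\<close>, where
    \<open>i \<le> part lam i\<close> holds although the part is 0; for \<open>i \<ge> 1\<close> it
    is automatic.\<close>
  have "{i. 1 \<le> i \<and> i \<le> part lam i \<and> 0 < part lam i} =
      {1..card {i. 1 \<le> i \<and> i \<le> part lam i \<and> 0 < part lam i}}"
    by (rule initial_segment_part[where P = "\<lambda>i. i \<le> part lam i \<and> 0 < part lam i"]) auto
  moreover have "{i. 1 \<le> i \<and> i \<le> part lam i \<and> 0 < part lam i} = {i. 1 \<le> i \<and> i \<le> part lam i}"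
    by auto
  ultimately have "{i. 1 \<le> i \<and> i \<le> part lam i} = {1..rank}"
    unfolding frobenius_rank_def by (simp only:)
  then show ?thesis using assms by (auto simp: set_eq_iff)
qed

lemma rank_le: "rank \<le> r"
  using le_rank_iff[of rank] part_le[of rank] by (cases "rank = 0") (auto split: if_splits)

text \<open>The rows that reach column \<open>j\<close> form an initial segment whose length is the
  height of that column. The bound on \<open>j\<close> keeps it within the length of the conjugate
  list, so that \<open>part\<close> does not return its default.\<close>

lemma conjugate_galois:
  assumes "1 \<le> i" "1 \<le> j" "j \<le> part lam 1"
  shows "i \<le> part (conjugate_partition lam) j \<longleftrightarrow> j \<le> part lam i"
proof -
  have "{i. 1 \<le> i \<and> j \<le> part lam i} = {1..card {i. 1 \<le> i \<and> j \<le> part lam i}}"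
    by (rule initial_segment_part[where P = "\<lambda>i. j \<le> part lam i"]) (use assms(2) in auto)
  moreover have "part (conjugate_partition lam) j = card {i. 1 \<le> i \<and> j \<le> part lam i}"
    using assms unfolding conjugate_partition_def part_map by (simp del: upt_Suc)
  ultimately have "{i. 1 \<le> i \<and> j \<le> part lam i} = {1..part (conjugate_partition lam) j}"
    by (simp only:)
  then show ?thesis using assms(1) by (auto simp: set_eq_iff)
qed

lemma conjugate_galois_rank:
  assumes "1 \<le> i" "1 \<le> j" "j \<le> rank"
  shows "i \<le> part (conjugate_partition lam) j \<longleftrightarrow> j \<le> part lam i"
  using conjugate_galois[OF assms(1,2)] le_rank_iff[of j] part_antimono[of 1 j] assms by simp

lemma le_conjugate: "1 \<le> j \<Longrightarrow> j \<le> rank \<Longrightarrow> j \<le> part (conjugate_partition lam) j"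
  using conjugate_galois_rank[of j j] le_rank_iff[of j] by simp

text \<open>The last box of column \<open>j\<close> lies in a nonempty row, hence in one of the
  first \<open>r\<close> rows.\<close>

lemma leg_less:
  assumes "1 \<le> j" "j \<le> rank"
  shows "leg lam j < r"
proof -
  let ?c = "part (conjugate_partition lam) j"
  have "1 \<le> ?c" using le_conjugate[OF assms] assms(1) by linarith
  then have "j \<le> part lam ?c" using conjugate_galois_rank[of ?c j] assms by blast
  then have "0 < part lam ?c" using assms(1) by linarith
  then have "?c \<le> r" using part_le[OF \<open>1 \<le> ?c\<close>] by (cases "?c \<le> r") simp_all
  then show ?thesis using \<open>1 \<le> ?c\<close> assms(1) unfolding leg_def by linarith
qed

lemma leg_strict_antimono:
  assumes "1 \<le> i" "i < j" "j \<le> rank"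
  shows "leg lam j < leg lam i"
proof -
  let ?c = "part (conjugate_partition lam)"
  have j: "j \<le> ?c j" using le_conjugate assms by simp
  then have "j \<le> part lam (?c j)" using conjugate_galois_rank[of "?c j" j] assms by simp
  then have "?c j \<le> ?c i" using conjugate_galois_rank[of "?c j" i] assms j by simp
  then show ?thesis using j assms by (simp add: leg_def)
qed

lemma arm_strict_antimono:
  assumes "1 \<le> i" "i < j" "j \<le> rank"
  shows "arm lam j < arm lam i"
  using part_antimono[of i j] le_rank_iff[of j] assms by (simp add: arm_def)

lemma arm_less: "1 \<le> i \<Longrightarrow> i \<le> rank \<Longrightarrow> r + arm lam i < N"
  using part_le[of i] le_rank_iff[of i] rank_le r_le_N by (auto simp: arm_def)

text \<open>The positions below \<open>r\<close> that the partition vacates, in increasing order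
  because legs decrease.\<close>

definition leg_positions :: "nat list" where
  "leg_positions = map (\<lambda>j. r - 1 - leg lam (j + 1)) [0..<rank]"

text \<open>The positions from \<open>r\<close> on that it occupies, in decreasing order; hence the
  reversal in \<open>index_list\<close>.\<close>

definition arm_positions :: "nat list" where
  "arm_positions = map (\<lambda>i. r + arm lam (i + 1)) [0..<rank]"

definition index_list :: "nat list" where
  "index_list = filter (\<lambda>x. x \<notin> set leg_positions) [0..<r] @ rev arm_positions"

lemma sorted_leg_positions: "sorted_wrt (<) leg_positions"
  unfolding leg_positions_def sorted_wrt_iff_nth_less
proof (simp, intro allI impI)
  fix i j assume "i < j" "j < rank"
  then show "r - Suc (leg lam (Suc i)) < r - Suc (leg lam (Suc j))"
    using leg_strict_antimono[of "Suc i" "Suc j"] leg_less[of "Suc i"] by simp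
qed

lemma leg_positions_less: "set leg_positions \<subseteq> {..<r}"
  using leg_less by (fastforce simp: leg_positions_def)

lemma sorted_rev_arm_positions: "sorted_wrt (<) (rev arm_positions)"
  unfolding sorted_wrt_rev unfolding arm_positions_def sorted_wrt_iff_nth_less
  using arm_strict_antimono by simp

lemma arm_positions_bounds: "set arm_positions \<subseteq> {r..<N}"
  using arm_less by (auto simp: arm_positions_def)

lemma sorted_index_list: "sorted_wrt (<) index_list"
  using sorted_rev_arm_positions arm_positions_bounds
  by (fastforce simp: index_list_def sorted_wrt_append strict_sorted_iff intro!: sorted_wrt_filter)

lemma index_list_less: "set index_list \<subseteq> {..<N}"
  using arm_positions_bounds r_le_N by (auto simp: index_list_def)

text \<open>Rows up to the rank land on the arm positions. The later rows land injectively below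
  \<open>r\<close> and avoid the leg positions; as there are \<open>r - rank\<close> of them, they
  fill all the rest.\<close>

lemma set_index_list: "set index_list = (\<lambda>i. part lam i + (r - i)) ` {1..r}"
proof -
  let ?f = "\<lambda>i. part lam i + (r - i)"
  have rank: "i \<le> part lam i" if "i \<in> {1..rank}" for i
    using that le_rank_iff[of i] by simp
  have rank': "part lam i < i" if "i \<in> {rank<..r}" for i
    using that le_rank_iff[of i] by simp
  have "set arm_positions = (\<lambda>i. r + arm lam (i + 1)) ` {0..<rank}"
    by (simp add: arm_positions_def)
  also have "\<dots> = (\<lambda>i. r + arm lam i) ` {1..rank}"
    by (simp add: image_image[of "\<lambda>i. r + arm lam i" Suc, symmetric] image_Suc_atLeastLessThan
      atLeastLessThanSuc_atLeastAtMost)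
  also have "\<dots> = ?f ` {1..rank}"
    using rank rank_le by (intro image_cong) (fastforce simp: arm_def)+
  finally have arms: "set arm_positions = ?f ` {1..rank}" .
  have "?f ` {rank<..r} = {..<r} - set leg_positions"
  proof (rule card_subset_eq)
    show "?f ` {rank<..r} \<subseteq> {..<r} - set leg_positions"
    proof (rule image_subsetI)
      fix i assume i: "i \<in> {rank<..r}"
      \<comment> \<open>If row \<open>i\<close> meets column \<open>j\<close>, then
        \<open>?f i\<close> lies strictly above the leg position, otherwise strictly below
        it.\<close>
      have "?f i \<noteq> r - 1 - leg lam j" if j: "1 \<le> j" "j \<le> rank" for j
        using conjugate_galois_rank[of i j] rank'[OF i] leg_less[of j] le_conjugate[of j] i j
        by (cases "j \<le> part lam i") (auto simp: leg_def)
      then have "?f i \<noteq> r - 1 - leg lam (j + 1)" if "j < rank" for j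
        using that by simp
      then have "?f i \<notin> set leg_positions"
        unfolding leg_positions_def set_map set_upt by (metis (no_types, lifting) imageE atLeastLessThan_iff)
      moreover have "?f i < r" using rank'[OF i] i by auto
      ultimately show "?f i \<in> {..<r} - set leg_positions" by simp
    qed
    have "inj_on ?f {rank<..r}"
    proof (rule linorder_inj_onI)
      fix i j assume "i < j" "i \<in> {rank<..r}" "j \<in> {rank<..r}"
      then show "?f i \<noteq> ?f j" using part_antimono[of i j] by auto
    qed auto
    then have "card (?f ` {rank<..r}) = r - rank" by (subst card_image) simp_all
    also have "\<dots> = card ({..<r} - set leg_positions)"
    proof -
      have "distinct leg_positions" using sorted_leg_positions strict_sorted_iff by auto
      then have "card (set leg_positions) = rank"
        by (subst distinct_card) (simp_all add: leg_positions_def)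
      then show ?thesis using leg_positions_less by (subst card_Diff_subset) simp_all
    qed
    finally show "card (?f ` {rank<..r}) = card ({..<r} - set leg_positions)" .
  qed auto
  then have "set index_list = ?f ` ({1..rank} \<union> {rank<..r})"
    unfolding image_Un by (auto simp: index_list_def arms)
  also have "{1..rank} \<union> {rank<..r} = {1..r}" using rank_le by auto
  finally show ?thesis .
qed

end

subsection \<open>The Giambelli matrix\<close>

lemma prod_lessThan_add:
  fixes f :: "nat \<Rightarrow> 'a::comm_monoid_mult"
  shows "(\<Prod>j<p + q. f j) = (\<Prod>j<p. f j) * (\<Prod>j<q. f (p + j))"
  by (induction q) (simp_all add: mult.assoc)

section \<open>Entries of the Giambelli matrix, for any matrix with a unitriangular
  \<open>gauss_upper\<close>\<close>

context
  fixes N :: nat and A V :: "'a::field mat"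
  assumes U: "upper_unitriangular N (gauss_upper A)" and V: "upper_unitriangular N V"
    and VU: "V * gauss_upper A = 1\<^sub>m N"
begin

private abbreviation "u \<equiv> \<lambda>i j. gauss_upper A $$ (i, j)"
private abbreviation "v \<equiv> \<lambda>i j. V $$ (i, j)"

interpretation unitriangular_inverse N u v
  by (rule unitriangular_inverse_mat[OF U V VU])

lemma U_carrier: "gauss_upper A \<in> carrier_mat N N"
  using U by (simp add: upper_unitriangular_def)

lemma straightS_eq_ldet:
  assumes "r \<le> N" and "sorted_wrt (<) ys" "set ys \<subseteq> {..<N}"
    and "set ys = (\<lambda>i. part lam i + (r - i)) ` {1..r}"
  shows "straightS r lam A = ldet u [0..<r] ys"
  using assms index_empty[of r] by (intro skewS_eq_ldet[OF U_carrier]) (auto simp: atLeast0LessThan)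

lemma straightS_hook:
  assumes "b < r" "r + a < N"
  shows "straightS r (hook a b) A = (-1) ^ b * vmul r (r - 1 - b) (ucol (r + a))"
proof -
  let ?ys = "filter (\<lambda>x. x \<noteq> r - 1 - b) [0..<r] @ [r + a]"
  have "straightS r (hook a b) A = ldet u [0..<r] ?ys"
    using assms index_hook[OF assms(1), of a]
    by (intro straightS_eq_ldet) (auto simp: sorted_wrt_append intro!: sorted_wrt_filter)
  then show ?thesis using hook_minor[of r "r - 1 - b" "r + a"] assms by simp
qed

text \<open>The superscript \<open>r + g + 1\<close> makes \<open>r + g\<close> the last row of the
  minor, and \<open>row_minor\<close> reduces it to an entry in that row. Negative degrees
  correspond to entries below the diagonal, where both sides are 0.\<close>

lemma h_fun_eq:
  assumes "r + a < N" "r + g < N"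
  shows "h_fun (r + g + 1) (int a - int g) A = u (r + g) (r + a)"
proof (cases "a < g")
  case True
  then show ?thesis using u_lower[of "r + a" "r + g"] assms by (simp add: h_fun_def)
next
  case False
  define s d where "s = r + g + 1" and "d = a - g"
  have s: "0 < s" "s \<le> N" "s - 1 + d < N" using assms False by (auto simp: s_def d_def)
  have "straightS s (row_partition d) A = ldet u [0..<s] ([0..<s - 1] @ [s - 1 + d])"
    using s index_row[OF s(1), of d]
    by (intro straightS_eq_ldet) (auto simp: sorted_wrt_append)
  also have "\<dots> = u (s - 1) (s - 1 + d)" by (rule row_minor[OF s(1,2)])
  also have "s - 1 + d = r + a" using False by (simp add: s_def d_def)
  finally have "straightS s (row_partition d) A = u (r + g) (r + a)" by (simp add: s_def)
  moreover have "nat (int a - int g) = d" using False by (simp add: d_def)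
  ultimately show ?thesis using False by (simp add: h_fun_def s_def)
qed

text \<open>\<open>column_minor\<close> with \<open>t = r - d\<close> gives an entry of
  \<open>v\<close>, which is 0 below the diagonal just as \<open>e\<close> is in negative degree.
  The sign \<open>(-1)^(b - d)\<close> is split into a factor in \<open>b\<close> and a factor in
  \<open>d\<close> so that it can later be pulled out of columns and rows.\<close>

lemma e_fun_eq:
  assumes "b < r" "d < r" "r \<le> N"
  shows "e_fun (r - d - 1) (int b - int d) A =
    (-1) ^ b * vmul r (r - 1 - b) (unit (r - 1 - d)) * (-1) ^ d"
proof (cases "b < d")
  case True
  then have "v (r - 1 - b) (r - 1 - d) = 0" using assms by (intro v_lower) auto
  then show ?thesis using True assms by (simp add: e_fun_def vmul_unit)
next
  case False
  define t k where "t = r - d" and "k = b - d"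
  have t: "0 < t" "t \<le> N" "k \<le> t - 1" using assms False by (auto simp: t_def k_def)
  have "straightS (t - 1) (column_partition k) A =
      ldet u [0..<t - 1] (filter (\<lambda>x. x \<noteq> t - 1 - k) [0..<t])"
    using t index_column[OF t(3)]
    by (intro straightS_eq_ldet) (auto intro!: sorted_wrt_filter)
  also have "\<dots> = (-1) ^ k * v (t - 1 - k) (t - 1)"
    using column_minor[of "t - 1 - k" t] t by simp
  also have "t - 1 - k = r - 1 - b" using False assms by (simp add: t_def k_def)
  also have "v (r - 1 - b) (t - 1) = vmul r (r - 1 - b) (unit (r - 1 - d))"
    using assms by (simp add: vmul_unit t_def)
  also have "(-1 :: 'a) ^ k = (-1) ^ b * (-1) ^ d"
  proof -
    have "b = k + d" using False by (simp add: k_def)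
    then show ?thesis using minus_one_power_mult_self[of d "1 :: 'a"]
      by (simp add: power_add mult.assoc)
  qed
  finally have "straightS (t - 1) (column_partition k) A =
      (-1) ^ b * vmul r (r - 1 - b) (unit (r - 1 - d)) * (-1) ^ d"
    by (simp add: mult_ac)
  moreover have "nat (int b - int d) = k" using False by (simp add: k_def)
  ultimately show ?thesis using False by (simp add: e_fun_def t_def)
qed

text \<open>The Giambelli matrix is the transpose of the matrix left by \<open>skew_minor\<close>,
  with rows and columns rescaled by signs. The product of these signs equals the leg part of the
  sign in \<open>skew_minor\<close>, so only \<open>(-1)^q\<close> survives.\<close>

lemma skew_giambelli:
  assumes "r \<le> N" "is_partition lam" "is_partition mu" "contained mu lam"
    and "contained lam (replicate r (N - r))"
  shows "skewS r lam mu A = (-1) ^ frobenius_rank mu * det (giambelli_mat r lam mu A)"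
proof -
  interpret lam: partition_in_rectangle lam r N
    by unfold_locales (use assms in auto)
  have "contained mu (replicate r (N - r))"
    using assms(4,5) unfolding contained_def by (meson le_trans)
  then interpret mu: partition_in_rectangle mu r N
    by unfold_locales (use assms in auto)
  define p q where "p = frobenius_rank lam" and "q = frobenius_rank mu"
  let ?bs = lam.leg_positions and ?as = lam.arm_positions
  let ?ds = mu.leg_positions and ?gs = mu.arm_positions
  let ?rs = "?bs @ ?gs" and ?cs = "map ucol ?as @ map unit ?ds"
  \<comment> \<open>The columns with \<open>j < p\<close> carry the sign of a leg of
    \<open>lam\<close>, the rows with \<open>i \<ge> p\<close> that of a leg of
    \<open>mu\<close>.\<close>
  let ?x = "\<lambda>j. if j < p then (-1) ^ leg lam (j + 1) else (1 :: 'a)"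
  let ?y = "\<lambda>i. if i < p then (1 :: 'a) else (-1) ^ leg mu (i - p + 1)"
  let ?sb = "\<Sum>b\<leftarrow>?bs. r - 1 - b" and ?sd = "\<Sum>d\<leftarrow>?ds. r - 1 - d"
  have len: "length ?bs = p" "length ?as = p" "length ?ds = q" "length ?gs = q"
    by (simp_all add: lam.leg_positions_def lam.arm_positions_def
      mu.leg_positions_def mu.arm_positions_def p_def q_def)
  have bs: "?bs ! j = r - 1 - leg lam (j + 1)" "?as ! j = r + arm lam (j + 1)" if "j < p" for j
    using that by (simp_all add: lam.leg_positions_def lam.arm_positions_def p_def)
  have ds: "?ds ! j = r - 1 - leg mu (j + 1)" "?gs ! j = r + arm mu (j + 1)" if "j < q" for j
    using that by (simp_all add: mu.leg_positions_def mu.arm_positions_def q_def)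
  have legs: "leg lam (j + 1) < r" "r + arm lam (j + 1) < N" if "j < p" for j
    using that lam.leg_less[of "j + 1"] lam.arm_less[of "j + 1"] by (simp_all add: p_def)
  have legs': "leg mu (j + 1) < r" "r + arm mu (j + 1) < N" if "j < q" for j
    using that mu.leg_less[of "j + 1"] mu.arm_less[of "j + 1"] by (simp_all add: q_def)
  have sub: "r - Suc (r - Suc k) = k" if "k < r" for k using that by simp
  \<comment> \<open>For a leg position \<open>b\<close>, the number \<open>r - 1 - b\<close> of
    entries it passes is the leg itself.\<close>
  have sums: "?sb = (\<Sum>j\<leftarrow>[0..<p]. leg lam (j + 1))" "?sd = (\<Sum>j\<leftarrow>[0..<q]. leg mu (j + 1))"
    unfolding lam.leg_positions_def mu.leg_positions_def map_map p_def[symmetric] q_def[symmetric]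
    using legs(1) legs'(1)
    by (auto intro!: arg_cong[where f = sum_list] simp: sub)
  have "skewS r lam mu A = ldet u mu.index_list lam.index_list"
    by (rule skewS_eq_ldet[OF U_carrier mu.sorted_index_list mu.index_list_less
      lam.sorted_index_list lam.index_list_less mu.set_index_list lam.set_index_list])
  also have "\<dots> = (-1) ^ (q + ?sb + ?sd) * ldet (vmul r) ?rs ?cs"
    unfolding lam.index_list_def mu.index_list_def len(3)[symmetric]
    using mu.sorted_rev_arm_positions
    by (intro skew_minor assms(1) lam.sorted_leg_positions lam.leg_positions_less
      mu.sorted_leg_positions mu.leg_positions_less mu.arm_positions_bounds)
      (simp_all add: len strict_sorted_iff)
  finally have skew: "skewS r lam mu A = (-1) ^ (q + ?sb + ?sd) * ldet (vmul r) ?rs ?cs" .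
  let ?G = "giambelli_mat r lam mu A"
  have G: "?G \<in> carrier_mat (p + q) (p + q)"
    unfolding giambelli_mat_def Let_def p_def[symmetric] q_def[symmetric] by auto
  have entry: "?G $$ (i, j) = ?x j * vmul r (?rs ! j) (?cs ! i) * ?y i"
    if ij: "i < p + q" "j < p + q" for i j
  proof -
    consider "i < p" "j < p" | "i < p" "\<not> j < p" | "\<not> i < p" "j < p" | "\<not> i < p" "\<not> j < p"
      by blast
    then show ?thesis
    proof cases
      case 1
      then have "?G $$ (i, j) = straightS r (hook (arm lam (i + 1)) (leg lam (j + 1))) A"
        unfolding giambelli_mat_def Let_def p_def[symmetric] q_def[symmetric] by simp
      then show ?thesis
        using 1 len bs legs by (simp add: nth_append straightS_hook)
    next
      case 2
      then have "?G $$ (i, j) = h_fun (r + arm mu (j - p + 1) + 1)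
          (int (arm lam (i + 1)) - int (arm mu (j - p + 1))) A"
        unfolding giambelli_mat_def Let_def p_def[symmetric] q_def[symmetric] using ij by simp
      also have "\<dots> = u (r + arm mu (j - p + 1)) (r + arm lam (i + 1))"
        using 2 ij by (intro h_fun_eq legs legs') auto
      finally show ?thesis
        using 2 ij len bs ds by (simp add: nth_append vmul_def)
    next
      case 3
      then have "?G $$ (i, j) = e_fun (r - leg mu (i - p + 1) - 1)
          (int (leg lam (j + 1)) - int (leg mu (i - p + 1))) A"
        unfolding giambelli_mat_def Let_def p_def[symmetric] q_def[symmetric] using ij by simp
      also have "\<dots> = (-1) ^ leg lam (j + 1) * vmul r (r - 1 - leg lam (j + 1))
          (unit (r - 1 - leg mu (i - p + 1))) * (-1) ^ leg mu (i - p + 1)"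
        using 3 ij assms(1) by (intro e_fun_eq legs legs') auto
      finally show ?thesis
        using 3 ij len bs ds by (simp add: nth_append)
    next
      case 4
      then have "?G $$ (i, j) = 0"
        unfolding giambelli_mat_def Let_def p_def[symmetric] q_def[symmetric] using ij by simp
      moreover have "i - p < q" "j - p < q" using 4 ij by auto
      \<comment> \<open>The unit columns are supported below \<open>r\<close> and these rows lie at
        or beyond \<open>r\<close>, which yields the zero block.\<close>
      moreover have "r + arm mu (j - p + 1) \<noteq> r - 1 - leg mu (i - p + 1)"
        using legs'(1)[OF \<open>i - p < q\<close>] by linarith
      ultimately show ?thesis
        using 4 ij len ds by (simp add: nth_append vmul_def)
    qed
  qed
  let ?n = "p + q"
  have "det ?G = det (transpose_mat ?G)" by (rule det_transpose[OF G, symmetric])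
  also have "transpose_mat ?G = mat ?n ?n (\<lambda>(j, i). ?x j * vmul r (?rs ! j) (?cs ! i) * ?y i)"
    using G entry by (intro eq_matI) auto
  also have "det \<dots> = ldet (\<lambda>j i. ?x j * vmul r (?rs ! j) (?cs ! i) * ?y i) [0..<?n] [0..<?n]"
    unfolding ldet_def by (rule arg_cong[where f = det]) (auto intro!: eq_matI)
  also have "\<dots> = (\<Prod>j\<leftarrow>[0..<?n]. ?x j) *
      ldet (\<lambda>j i. vmul r (?rs ! j) (?cs ! i)) [0..<?n] [0..<?n] * (\<Prod>i\<leftarrow>[0..<?n]. ?y i)"
    by (rule ldet_scale) simp
  also have "ldet (\<lambda>j i. vmul r (?rs ! j) (?cs ! i)) [0..<?n] [0..<?n] =
      ldet (vmul r) (map ((!) ?rs) [0..<?n]) (map ((!) ?cs) [0..<?n])"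
    by (rule ldet_map[symmetric])
  also have "map ((!) ?rs) [0..<?n] = ?rs" using map_nth[of ?rs] len by simp
  also have "map ((!) ?cs) [0..<?n] = ?cs" using map_nth[of ?cs] len by simp
  also have "(\<Prod>j\<leftarrow>[0..<?n]. ?x j) = (-1) ^ ?sb"
  proof -
    have "(\<Prod>j\<leftarrow>[0..<?n]. ?x j) = (\<Prod>j<?n. ?x j)"
      by (simp add: prod.distinct_set_conv_list[symmetric] atLeast0LessThan)
    also have "\<dots> = (\<Prod>j<p. ?x j) * (\<Prod>j<q. ?x (p + j))"
      by (rule prod_lessThan_add)
    finally show ?thesis
      unfolding sums by (simp add: sum_list_distinct_conv_sum_set atLeast0LessThan power_sum)
  qed
  also have "(\<Prod>i\<leftarrow>[0..<?n]. ?y i) = (-1) ^ ?sd"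
  proof -
    have "(\<Prod>j\<leftarrow>[0..<?n]. ?y j) = (\<Prod>j<?n. ?y j)"
      by (simp add: prod.distinct_set_conv_list[symmetric] atLeast0LessThan)
    also have "\<dots> = (\<Prod>j<p. ?y j) * (\<Prod>j<q. ?y (p + j))"
      by (rule prod_lessThan_add)
    finally show ?thesis
      unfolding sums by (simp add: sum_list_distinct_conv_sum_set atLeast0LessThan power_sum)
  qed
  finally have det_G: "det ?G = (-1) ^ ?sb * ldet (vmul r) ?rs ?cs * (-1) ^ ?sd" .
  have "(-1) ^ (q + m + n) * x = (-1) ^ q * ((-1) ^ m * x * (-1) ^ n)" for m n and x :: 'a
    by (simp add: power_add mult_ac)
  then show ?thesis unfolding skew det_G q_def[symmetric] .
qed

end

theorem theorem2p3:
  fixes N r :: nat and lam mu :: "nat list"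
  assumes "N > 0" and "r \<le> N"
    and "is_partition lam" and "is_partition mu"
    and "contained mu lam"
    and "contained lam (replicate r (N - r))"
  shows "skewS r lam mu (generic_mat N) =
           (-1) ^ frobenius_rank mu * det (giambelli_mat r lam mu (generic_mat N))"
proof -
  let ?U = "gauss_upper (generic_mat N)"
  have U: "upper_unitriangular N ?U" by (rule upper_unitriangular_gauss_upper)
  then have "?U \<in> carrier_mat N N" by (simp add: upper_unitriangular_def)
  then obtain V where V: "V \<in> carrier_mat N N" "V * ?U = 1\<^sub>m N"
    using obtain_inverse_mat[of ?U N] det_upper_unitriangular[OF U] by auto
  show ?thesis
    by (rule skew_giambelli[OF U upper_unitriangular_inverse[OF U V] V(2) assms(2-6)])
qed

end
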